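(* Let $(\Sigma;V_1,V_2,V_3)$ be a $(g;k_1,k_2,k_3)$-trisection of a smooth closed oriented $4$-manifold $X$, and let $L_\alpha,L_\beta,L_\gamma\subset H_1(\Sigma;\mathbb{Z})$ be the associated Lagrangian subgroups. Then $$H_3(X;\mathbb{Z})\cong L_\alpha\cap L_\beta\cap L_\gamma.$$
   Context: All homology is with $\mathbb{Z}$ coefficients. A $(g;k_1,k_2,k_3)$-trisection $(\Sigma;V_1,V_2,V_3)$ of a smooth closed oriented (connected) $4$-manifold $X$ is a decomposition $X=V_1\cup V_2\cup V_3$ such that each $V_i$ is diffeomorphic to the boundary connected sum $\natural^{k_i}(S^1\times B^3)$, each pairwise intersection is a genus $g$ three-dimensional handlebody, and $\Sigma=V_1\cap V_2\cap V_3$ is a closed connected genus $g$ surface which is the boundary of each of the three handlebodies. Write $W_\alpha=V_1\cap V_2$, $W_\beta=V_1\cap V_3$, $W_\gamma=V_2\cap V_3$; thus $\partial V_1=W_\alpha\cup W_\beta$, $\partial V_2=W_\alpha\cup W_\gamma$, $\partial V_3=W_\beta\cup W_\gamma$ are genus $g$ Heegaard splittings of $\#^{k_i}(S^1\times S^2)$. For $\epsilon\in\{\alpha,\beta,\gamma\}$ put $L_\epsilon=\ker(H_1(\Sigma)\to H_1(W_\epsilon))$, the map being induced by inclusion. *)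

theory Defs
  imports "HOL-Analysis.Analysis" "HOL-Homology.Homology"
begin

section \<open>Smooth maps between subsets of Euclidean spaces\<close>

text \<open>
  \<open>cinfinity_on T f\<close> (for open \<open>T\<close>): \<open>f\<close> is differentiable on \<open>T\<close>, and so are all its iterated
  directional derivatives. All of these are then continuous, so this is \<open>C\<^sup>\<infinity>\<close> in the usual sense.
\<close>

coinductive cinfinity_on ::
    "'e::euclidean_space set \<Rightarrow> ('e \<Rightarrow> 'f::euclidean_space) \<Rightarrow> bool" for T where
  "\<lbrakk>\<forall>x\<in>T. f differentiable (at x);
    \<forall>v. cinfinity_on T (\<lambda>x. frechet_derivative f (at x) v)\<rbrakk> \<Longrightarrow> cinfinity_on T f"

definition smooth_on :: "'e::euclidean_space set \<Rightarrow> ('e \<Rightarrow> 'f::euclidean_space) \<Rightarrow> bool" where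
  "smooth_on S f \<longleftrightarrow>
    (\<forall>x\<in>S. \<exists>T g. open T \<and> x \<in> T \<and> cinfinity_on T g \<and> (\<forall>y\<in>S \<inter> T. g y = f y))"

section \<open>Smooth manifolds with boundary\<close>

text \<open>A chart \<open>(U, \<phi>)\<close>; only the values of \<open>\<phi>\<close> on \<open>U\<close> matter.\<close>

type_synonym ('a, 'e) chart = "'a set \<times> ('a \<Rightarrow> 'e)"

record ('a, 'e) mfd =
  mtop :: "'a topology"
  atlas :: "('a, 'e) chart set"

text \<open>
  The image of a chart is open in a half-space \<open>{x. 0 \<le> a \<bullet> x}\<close>, \<open>a \<noteq> 0\<close>, or (case \<open>a = 0\<close>)
  open in the whole Euclidean space.
\<close>

definition is_chart :: "'a topology \<Rightarrow> ('a, 'e::euclidean_space) chart \<Rightarrow> bool" where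
  "is_chart X c \<longleftrightarrow> (case c of (U, \<phi>) \<Rightarrow>
     openin X U \<and>
     (\<exists>a. openin (top_of_set {x. 0 \<le> a \<bullet> x}) (\<phi> ` U)) \<and>
     homeomorphic_map (subtopology X U) (top_of_set (\<phi> ` U)) \<phi>)"

definition transition ::
    "('a, 'e::euclidean_space) chart \<Rightarrow> ('a, 'f::euclidean_space) chart \<Rightarrow> 'e \<Rightarrow> 'f" where
  "transition c d = snd d \<circ> inv_into (fst c) (snd c)"

definition compatible ::
    "('a, 'e::euclidean_space) chart \<Rightarrow> ('a, 'f::euclidean_space) chart \<Rightarrow> bool" where
  "compatible c d \<longleftrightarrow>
     smooth_on (snd c ` (fst c \<inter> fst d)) (transition c d) \<and>
     smooth_on (snd d ` (fst c \<inter> fst d)) (transition d c)"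

definition smooth_manifold :: "('a, 'e::euclidean_space) mfd \<Rightarrow> bool" where
  "smooth_manifold M \<longleftrightarrow>
     Hausdorff_space (mtop M) \<and> second_countable (mtop M) \<and>
     (\<forall>c\<in>atlas M. is_chart (mtop M) c) \<and>
     topspace (mtop M) = (\<Union>c\<in>atlas M. fst c) \<and>
     (\<forall>c\<in>atlas M. \<forall>d\<in>atlas M. compatible c d)"

definition max_atlas :: "('a, 'e::euclidean_space) mfd \<Rightarrow> ('a, 'e) chart set" where
  "max_atlas M = {c. is_chart (mtop M) c \<and> (\<forall>d\<in>atlas M. compatible c d)}"

definition mfd_boundary :: "('a, 'e::euclidean_space) mfd \<Rightarrow> 'a set" where
  "mfd_boundary M = {p. \<exists>(U, \<phi>)\<in>atlas M. p \<in> U \<and> \<phi> p \<notin> interior (\<phi> ` U)}"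

text \<open>
  The structure induced on a subset \<open>S\<close> of \<open>X\<close>: its charts are the homeomorphisms from relatively
  open subsets of \<open>S\<close> onto (half-space) open subsets of \<open>'f\<close> that are smooth in both directions
  when read in the charts of \<open>X\<close>. The subset \<open>S\<close> is a smooth submanifold, possibly with boundary,
  of dimension \<open>DIM('f)\<close> iff \<open>smooth_manifold (submfd X S)\<close>. For open \<open>S\<close> and equal dimensions this
  is the open submanifold \<open>S\<close>, with its maximal atlas.
\<close>

definition submfd ::
    "('a, 'e::euclidean_space) mfd \<Rightarrow> 'a set \<Rightarrow> ('a, 'f::euclidean_space) mfd" where
  "submfd X S = \<lparr>mtop = subtopology (mtop X) S,
     atlas = {c. is_chart (subtopology (mtop X) S) c \<and> (\<forall>d\<in>atlas X. compatible c d)}\<rparr>"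

definition euclidean_mfd :: "('e::euclidean_space, 'e) mfd" where
  "euclidean_mfd = \<lparr>mtop = euclidean, atlas = {(UNIV, id)}\<rparr>"

definition smooth_map ::
    "('a, 'e::euclidean_space) mfd \<Rightarrow> ('b, 'f::euclidean_space) mfd \<Rightarrow> ('a \<Rightarrow> 'b) \<Rightarrow> bool" where
  "smooth_map M N f \<longleftrightarrow> continuous_map (mtop M) (mtop N) f \<and>
     (\<forall>(U, \<phi>)\<in>atlas M. \<forall>(V, \<psi>)\<in>atlas N.
        smooth_on (\<phi> ` {p\<in>U. f p \<in> V}) (\<psi> \<circ> f \<circ> inv_into U \<phi>))"

definition diffeomorphism ::
    "('a, 'e::euclidean_space) mfd \<Rightarrow> ('b, 'f::euclidean_space) mfd \<Rightarrow> ('a \<Rightarrow> 'b) \<Rightarrow> bool" where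
  "diffeomorphism M N f \<longleftrightarrow> smooth_map M N f \<and>
     (\<exists>g. smooth_map N M g \<and>
          (\<forall>x\<in>topspace (mtop M). g (f x) = x) \<and> (\<forall>y\<in>topspace (mtop N). f (g y) = y))"

definition diffeomorphic ::
    "('a, 'e::euclidean_space) mfd \<Rightarrow> ('b, 'f::euclidean_space) mfd \<Rightarrow> bool" where
  "diffeomorphic M N \<longleftrightarrow> (\<exists>f. diffeomorphism M N f)"

text \<open>The atlas of \<open>X\<close> represents the orientation. Meant for manifolds without boundary.\<close>

definition oriented_atlas :: "('a, real^'n) mfd \<Rightarrow> bool" where
  "oriented_atlas X \<longleftrightarrow>
     (\<forall>c\<in>atlas X. \<forall>d\<in>atlas X. \<forall>p\<in>fst c \<inter> fst d.
        0 < det (matrix (frechet_derivative (transition c d) (at (snd c p)))))"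

definition closed_oriented_manifold :: "('a, real^'n) mfd \<Rightarrow> bool" where
  "closed_oriented_manifold X \<longleftrightarrow> smooth_manifold X \<and> compact_space (mtop X) \<and>
     mfd_boundary X = {} \<and> oriented_atlas X"

section \<open>Connected sums and boundary connected sums\<close>

text \<open>
  \<open>glued_sum a M1 M2 M\<close>: \<open>M\<close> is the smooth gluing of \<open>M1 - p1\<close> and \<open>M2 - p2\<close> that identifies
  \<open>i1 (r u)\<close> with \<open>i2 ((1 - r) u)\<close> for \<open>0 < r < 1\<close> and unit vectors \<open>u\<close> of
  \<open>H = {x. 0 \<le> a \<bullet> x}\<close>, where \<open>i1\<close>, \<open>i2\<close> are embeddings of the closed unit ball of \<open>H\<close>
  (inverses of charts onto the ball of radius 2 of \<open>H\<close>) sending \<open>0\<close> to \<open>p1\<close>, \<open>p2\<close>. For \<open>a = 0\<close>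
  this is the connected sum; for \<open>a \<noteq> 0\<close> the half balls sit at boundary points and this is the
  boundary connected sum (Kosinski, Differential Manifolds, Ch. VI). No orientation condition is put
  on \<open>i1\<close>, \<open>i2\<close>: below, \<open>M2\<close> always has an orientation reversing diffeomorphism, so that the
  result does not depend on it. \<open>M\<close> is Hausdorff etc. because it is assumed to be a manifold.
\<close>

definition glued_sum ::
    "'e::euclidean_space \<Rightarrow> ('a, 'e) mfd \<Rightarrow> ('b, 'e) mfd \<Rightarrow> ('c, 'e) mfd \<Rightarrow> bool" where
  "glued_sum a M1 M2 M \<longleftrightarrow>
     smooth_manifold M1 \<and> smooth_manifold M2 \<and> smooth_manifold M \<and>
     (\<exists>U1 \<phi>1 U2 \<phi>2 f1 f2 O1 O2.
        let H = {x. 0 \<le> a \<bullet> x};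
            i1 = inv_into U1 \<phi>1; i2 = inv_into U2 \<phi>2;
            P1 = topspace (mtop M1) - {i1 0}; P2 = topspace (mtop M2) - {i2 0}
        in (U1, \<phi>1) \<in> max_atlas M1 \<and> \<phi>1 ` U1 = ball 0 2 \<inter> H \<and>
           (U2, \<phi>2) \<in> max_atlas M2 \<and> \<phi>2 ` U2 = ball 0 2 \<inter> H \<and>
           openin (mtop M) O1 \<and> openin (mtop M) O2 \<and> O1 \<union> O2 = topspace (mtop M) \<and>
           diffeomorphism (submfd M1 P1 :: ('a, 'e) mfd) (submfd M O1 :: ('c, 'e) mfd) f1 \<and>
           diffeomorphism (submfd M2 P2 :: ('b, 'e) mfd) (submfd M O2 :: ('c, 'e) mfd) f2 \<and>
           (\<forall>q1\<in>P1. \<forall>q2\<in>P2. f1 q1 = f2 q2 \<longleftrightarrow>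
              (\<exists>r u. 0 < r \<and> r < 1 \<and> norm u = 1 \<and> u \<in> H \<and>
                     q1 = i1 (r *\<^sub>R u) \<and> q2 = i2 ((1 - r) *\<^sub>R u))))"

definition connected_sum ::
    "('a, 'e::euclidean_space) mfd \<Rightarrow> ('b, 'e) mfd \<Rightarrow> ('c, 'e) mfd \<Rightarrow> bool" where
  "connected_sum M1 M2 M \<longleftrightarrow> glued_sum 0 M1 M2 M"

definition boundary_connected_sum ::
    "('a, 'e::euclidean_space) mfd \<Rightarrow> ('b, 'e) mfd \<Rightarrow> ('c, 'e) mfd \<Rightarrow> bool" where
  "boundary_connected_sum M1 M2 M \<longleftrightarrow> (\<exists>a. a \<noteq> 0 \<and> glued_sum a M1 M2 M)"

text \<open>
  \<open>M\<close> is the boundary connected sum of \<open>k\<close> copies of \<open>N\<close>; the empty sum is the ball. Taking the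
  intermediate manifolds on the same type as \<open>M\<close> is no restriction, as all nonempty positive-dimensional
  manifolds have the same cardinality.
\<close>

inductive boundary_sum_copies ::
    "('b, 'e::euclidean_space) mfd \<Rightarrow> nat \<Rightarrow> ('a, 'e) mfd \<Rightarrow> bool" for N where
  "\<lbrakk>smooth_manifold M; diffeomorphic M (submfd euclidean_mfd (cball (0::'e) 1) :: ('e, 'e) mfd)\<rbrakk>
     \<Longrightarrow> boundary_sum_copies N 0 M"
| "\<lbrakk>boundary_sum_copies N k M1; boundary_connected_sum M1 N M\<rbrakk>
     \<Longrightarrow> boundary_sum_copies N (Suc k) M"

definition handlebody4 :: "nat \<Rightarrow> ('a, real^4) mfd \<Rightarrow> bool" where
  "handlebody4 k M \<longleftrightarrow>
     boundary_sum_copies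
       (submfd euclidean_mfd (sphere (0::real^2) 1 \<times> cball (0::real^3) 1)
          :: ((real^2) \<times> (real^3), real^4) mfd) k M"

definition handlebody3 :: "nat \<Rightarrow> ('a, real^3) mfd \<Rightarrow> bool" where
  "handlebody3 g M \<longleftrightarrow>
     boundary_sum_copies
       (submfd euclidean_mfd (sphere (0::real^2) 1 \<times> cball (0::real^2) 1)
          :: ((real^2) \<times> (real^2), real^3) mfd) g M"

definition torus :: "((real^2) \<times> (real^2), real^2) mfd" where
  "torus = submfd euclidean_mfd (sphere (0::real^2) 1 \<times> sphere (0::real^2) 1)"

text \<open>Closed connected oriented surfaces of genus \<open>g\<close>: the sphere with \<open>g\<close> tori summed on.\<close>

inductive genus_surface :: "nat \<Rightarrow> ('a, real^2) mfd \<Rightarrow> bool" where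
  "\<lbrakk>smooth_manifold M;
    diffeomorphic M (submfd euclidean_mfd (sphere (0::real^3) 1) :: (real^3, real^2) mfd)\<rbrakk>
     \<Longrightarrow> genus_surface 0 M"
| "\<lbrakk>genus_surface g M1; connected_sum M1 torus M\<rbrakk> \<Longrightarrow> genus_surface (Suc g) M"

section \<open>Trisections\<close>

text \<open>
  The pieces of a trisection have a corner along \<open>S\<close>, so "diffeomorphic to a 1-handlebody" is
  understood, as usual, after straightening the corner. \<open>M\<close> is the piece \<open>V\<close> with straightened
  corner: it has the same underlying space, the same smooth structure off \<open>S\<close>, and near \<open>S\<close> the
  quadrant in which \<open>V\<close> appears in suitable charts of \<open>X\<close> is opened up to a half-plane by
  complex squaring.
\<close>

definition straighten :: "real^4 \<Rightarrow> real^4" where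
  "straighten x = vector [(x$1)\<^sup>2 - (x$2)\<^sup>2, 2 * x$1 * x$2, x$3, x$4]"

definition corner_straightening ::
    "('a, real^4) mfd \<Rightarrow> 'a set \<Rightarrow> 'a set \<Rightarrow> ('a, real^4) mfd \<Rightarrow> bool" where
  "corner_straightening X V S M \<longleftrightarrow>
     smooth_manifold M \<and> mtop M = subtopology (mtop X) V \<and>
     atlas (submfd X (V - S) :: ('a, real^4) mfd) \<subseteq> max_atlas M \<and>
     (\<forall>p\<in>S. \<exists>(U, \<phi>)\<in>max_atlas X. p \<in> U \<and>
        (\<forall>q\<in>U. (q \<in> V \<longleftrightarrow> 0 \<le> \<phi> q $ 1 \<and> 0 \<le> \<phi> q $ 2) \<and>
               (q \<in> S \<longleftrightarrow> \<phi> q $ 1 = 0 \<and> \<phi> q $ 2 = 0)) \<and>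
        (U \<inter> V, straighten \<circ> \<phi>) \<in> max_atlas M)"

text \<open>
  Around every point of \<open>X\<close> the decomposition looks in some chart like \<open>\<real>\<^sup>2\<close> times the division of the
  plane into three convex sectors, in which respectively \<open>0\<close>, \<open>x\<^sub>1\<close>, \<open>x\<^sub>2\<close> is the least of
  the three numbers \<open>0, x\<^sub>1, x\<^sub>2\<close>. Any three rays bounding three convex sectors are linearly
  equivalent to these. As the chart may be centred anywhere, this covers interior points of the
  pieces, points on two pieces only, and points on the central surface.
\<close>

definition three_sectors ::
    "('a, real^4) mfd \<Rightarrow> 'a set \<Rightarrow> 'a set \<Rightarrow> 'a set \<Rightarrow> bool" where
  "three_sectors X V1 V2 V3 \<longleftrightarrow>
     (\<forall>p\<in>topspace (mtop X). \<exists>(U, \<phi>)\<in>max_atlas X. p \<in> U \<and>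
        (\<forall>q\<in>U. (q \<in> V1 \<longleftrightarrow> 0 \<le> \<phi> q $ 1 \<and> 0 \<le> \<phi> q $ 2) \<and>
               (q \<in> V2 \<longleftrightarrow> \<phi> q $ 1 \<le> 0 \<and> \<phi> q $ 1 \<le> \<phi> q $ 2) \<and>
               (q \<in> V3 \<longleftrightarrow> \<phi> q $ 2 \<le> 0 \<and> \<phi> q $ 2 \<le> \<phi> q $ 1)))"

definition trisection ::
    "('a, real^4) mfd \<Rightarrow> nat \<Rightarrow> nat \<Rightarrow> nat \<Rightarrow> nat \<Rightarrow>
     'a set \<Rightarrow> 'a set \<Rightarrow> 'a set \<Rightarrow> 'a set \<Rightarrow> bool" where
  "trisection X g k1 k2 k3 S V1 V2 V3 \<longleftrightarrow>
     V1 \<union> V2 \<union> V3 = topspace (mtop X) \<and> S = V1 \<inter> V2 \<inter> V3 \<and>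
     three_sectors X V1 V2 V3 \<and>
     (\<forall>(V, k) \<in> {(V1, k1), (V2, k2), (V3, k3)}.
        \<exists>M. corner_straightening X V S M \<and> handlebody4 k M) \<and>
     (\<forall>W \<in> {V1 \<inter> V2, V1 \<inter> V3, V2 \<inter> V3}.
        handlebody3 g (submfd X W) \<and> mfd_boundary (submfd X W :: ('a, real^3) mfd) = S) \<and>
     genus_surface g (submfd X S)"

definition lagrangian :: "'a topology \<Rightarrow> 'a set \<Rightarrow> 'a set \<Rightarrow> 'a chain set set" where
  "lagrangian X S W =
     kernel (homology_group 1 (subtopology X S)) (homology_group 1 (subtopology X W))
       (hom_induced 1 (subtopology X S) {} (subtopology X W) {} id)"

end

theory Submission
  imports Defs
begin

text \<open>
  The trisected manifold is glued in three steps: \<open>V\<^sub>2 \<union> V\<^sub>3\<close> along \<open>W\<^sub>\<gamma>\<close>, \<open>\<partial>V\<^sub>1 = W\<^sub>\<alpha> \<union> W\<^sub>\<beta>\<close> along the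
  surface \<open>\<Sigma>\<close>, and \<open>X = V\<^sub>1 \<union> (V\<^sub>2 \<union> V\<^sub>3)\<close> along \<open>\<partial>V\<^sub>1\<close>. One-handlebodies have no homology in degrees
  \<open>\<ge> 2\<close>, so the Mayer--Vietoris boundary maps
  \<open>H\<^sub>3(X) \<rightarrow> H\<^sub>2(\<partial>V\<^sub>1)\<close>, \<open>H\<^sub>2(\<partial>V\<^sub>1) \<rightarrow> H\<^sub>1(\<Sigma>)\<close> and \<open>H\<^sub>2(V\<^sub>2 \<union> V\<^sub>3) \<rightarrow> H\<^sub>1(W\<^sub>\<gamma>)\<close> are injective. The image of the
  second is \<open>L\<^sub>\<alpha> \<inter> L\<^sub>\<beta>\<close>; the image of the first is the kernel of \<open>H\<^sub>2(\<partial>V\<^sub>1) \<rightarrow> H\<^sub>2(V\<^sub>2 \<union> V\<^sub>3)\<close>, which by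
  naturality and injectivity of the third corresponds to \<open>L\<^sub>\<gamma>\<close>. No duality is needed.

  Excision for the closed pieces does not use collars: a homotopy that pushes a neighbourhood of each
  piece into this piece is assembled from the charts of \<open>three_sectors\<close> and compactness.
\<close>

section \<open>Excision and the Mayer--Vietoris boundary\<close>

lemma trivial_group_eq_one:
  assumes "trivial_group G" "x \<in> carrier G"
  shows "x = \<one>\<^bsub>G\<^esub>"
  using assms by (auto simp: trivial_group_def)

lemma trivial_groupI:
  assumes "group G" "\<And>x. x \<in> carrier G \<Longrightarrow> x = \<one>\<^bsub>G\<^esub>"
  shows "trivial_group G"
proof -
  have "\<one>\<^bsub>G\<^esub> \<in> carrier G"
    by (simp add: assms(1) group.is_monoid)
  then show ?thesis
    using assms unfolding trivial_group_def by blast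
qed

lemma trivial_group_inj_hom:
  assumes "h \<in> hom G H" "inj_on h (carrier G)" "trivial_group H" "group G"
  shows "trivial_group G"
proof -
  have "x = \<one>\<^bsub>G\<^esub>" if "x \<in> carrier G" for x
  proof (rule inj_onD[OF assms(2) _ that])
    show "h x = h \<one>\<^bsub>G\<^esub>"
      using assms that hom_in_carrier[OF assms(1)] group.is_monoid monoid.one_closed
      by (fastforce simp: trivial_group_def)
    show "\<one>\<^bsub>G\<^esub> \<in> carrier G"
      by (simp add: assms(4) group.is_monoid monoid.one_closed)
  qed
  with assms(4) show ?thesis
    by (rule trivial_groupI)
qed

lemma inj_on_hom_trivial:
  assumes "group G" "group H" "h \<in> hom G H"
    "\<And>x. x \<in> carrier G \<Longrightarrow> h x = \<one>\<^bsub>H\<^esub> \<Longrightarrow> x = \<one>\<^bsub>G\<^esub>"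
  shows "inj_on h (carrier G)"
  using assms group_hom.inj_on_one_iff[of G H h] by (auto simp: group_hom_def group_hom_axioms_def)

lemma hom_induced_one:
  "hom_induced p X S Y T f \<one>\<^bsub>relative_homology_group p X S\<^esub> = \<one>\<^bsub>relative_homology_group p Y T\<^esub>"
  by (rule hom_one[OF hom_induced_hom]) auto

text \<open>This and the next two lemmas restate the exactness axioms for single elements, at the
  relative group, at the subspace and at the whole space. The diagram chases below use this
  form.\<close>

lemma homology_exact_relative:
  "x \<in> carrier (relative_homology_group p X S) \<Longrightarrow>
   hom_boundary p X S x = \<one>\<^bsub>homology_group (p-1) (subtopology X S)\<^esub> \<longleftrightarrow>
   x \<in> hom_induced p X {} X S id ` carrier (homology_group p X)"
  using homology_exactness_axiom_1[of p X S] by (auto simp: kernel_def)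

lemma homology_exact_subspace:
  "x \<in> carrier (homology_group (p-1) (subtopology X S)) \<Longrightarrow>
   hom_induced (p-1) (subtopology X S) {} X {} id x = \<one>\<^bsub>homology_group (p-1) X\<^esub> \<longleftrightarrow>
   x \<in> hom_boundary p X S ` carrier (relative_homology_group p X S)"
  using homology_exactness_axiom_2[of p X S] by (auto simp: kernel_def)

lemma homology_exact_space:
  "x \<in> carrier (homology_group p X) \<Longrightarrow>
   hom_induced p X {} X S id x = \<one>\<^bsub>relative_homology_group p X S\<^esub> \<longleftrightarrow>
   x \<in> hom_induced p (subtopology X S) {} X {} id ` carrier (homology_group p (subtopology X S))"
  using homology_exactness_axiom_3[of p X S] by (auto simp: kernel_def)

section \<open>Excisive decompositions\<close>

text \<open>\<open>P\<close> constrains every stage of the homotopy, so all stages map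
  \<open>Y\<close> into itself and the same homotopy restricts to \<open>Y\<close>.\<close>

lemma homotopic_with_subtopology:
  assumes "homotopic_with P X X f g" "\<And>h. P h \<Longrightarrow> h ` Y \<subseteq> Y \<and> Q h"
  shows "homotopic_with Q (subtopology X Y) (subtopology X Y) f g"
proof -
  obtain h where h: "continuous_map (prod_topology (top_of_set {0..1}) X) X h"
    "\<forall>x. h (0, x) = f x" "\<forall>x. h (1, x) = g x" "\<forall>t\<in>{0..1::real}. P (\<lambda>x. h (t, x))"
    using assms(1) unfolding homotopic_with_def by blast
  have "continuous_map (prod_topology (top_of_set {0..1}) (subtopology X Y)) X h"
    using h(1) by (simp add: prod_topology_subtopology(2) continuous_map_from_subtopology)
  moreover have "h (t, x) \<in> Y" if "t \<in> {0..1}" "x \<in> Y" for t x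
    using h(4) assms(2) that by blast
  ultimately have "continuous_map (prod_topology (top_of_set {0..1}) (subtopology X Y)) (subtopology X Y) h"
    by (auto simp: continuous_map_in_subtopology)
  then show ?thesis
    unfolding homotopic_with_def using h assms(2) by blast
qed

text \<open>The conclusion of excision is taken as the definition, rather than a condition on
  interiors, so that closed pieces with thin intersection can qualify.\<close>

definition excisive :: "'a topology \<Rightarrow> 'a set \<Rightarrow> 'a set \<Rightarrow> bool" where
  "excisive Y A B \<longleftrightarrow> A \<union> B = topspace Y \<and>
     (\<forall>p. hom_induced p (subtopology Y B) (A \<inter> B) Y A id
          \<in> iso (relative_homology_group p (subtopology Y B) (A \<inter> B)) (relative_homology_group p Y A))"

text \<open>The excised set is the complement of \<open>B\<close>: it is closed because
  \<open>B\<close> is open, and it lies in the open set \<open>A\<close>.\<close>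

lemma excisive_open:
  assumes "openin Y A" "openin Y B" "A \<union> B = topspace Y"
  shows "excisive Y A B"
proof -
  let ?U = "topspace Y - B"
  have "Y closure_of ?U \<subseteq> Y interior_of A"
    using assms by (metis Diff_subset_conv Un_commute closedin_topspace closedin_diff closure_of_closedin interior_of_openin order_refl)
  moreover have "A \<subseteq> topspace Y" "topspace Y - ?U = B" "A - ?U = A \<inter> B"
    using assms openin_subset by blast+
  ultimately show ?thesis
    using homology_excision_axiom[of Y ?U A "topspace Y"] assms(3) by (simp add: excisive_def)
qed

text \<open>
  The inclusion is a retract, by means of \<open>g\<close>, of the excision isomorphism of the open cover
  \<open>{N, N'}\<close>.
\<close>

lemma excisive_homotopy:
  assumes hom: "homotopic_with (\<lambda>h. h ` A \<subseteq> A \<and> h ` B \<subseteq> B) Y Y id g"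
    and Y: "A \<union> B = topspace Y"
    and N: "openin Y N" "A \<subseteq> N" "g ` N \<subseteq> A"
    and N': "openin Y N'" "B \<subseteq> N'" "g ` N' \<subseteq> B"
  shows "excisive Y A B"
proof -
  have exc: "excisive Y N N'"
    using assms openin_subset by (intro excisive_open) blast+
  have g: "continuous_map Y Y g" "g ` A \<subseteq> A" "g ` B \<subseteq> B"
    using hom homotopic_with_imp_continuous_maps homotopic_with_imp_property by blast+
  have "hom_induced p (subtopology Y B) (A \<inter> B) Y A id
          \<in> iso (relative_homology_group p (subtopology Y B) (A \<inter> B)) (relative_homology_group p Y A)" for p
  proof -
    let ?G = "relative_homology_group p (subtopology Y B) (A \<inter> B)"
    let ?H = "relative_homology_group p Y A"
    let ?G' = "relative_homology_group p (subtopology Y N') (N \<inter> N')"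
    let ?H' = "relative_homology_group p Y N"
    define e where "e = hom_induced p (subtopology Y B) (A \<inter> B) Y A id"
    define e' where "e' = hom_induced p (subtopology Y N') (N \<inter> N') Y N id"
    define i where "i = hom_induced p (subtopology Y B) (A \<inter> B) (subtopology Y N') (N \<inter> N') id"
    define i' where "i' = hom_induced p Y A Y N id"
    define r where "r = hom_induced p (subtopology Y N') (N \<inter> N') (subtopology Y B) (A \<inter> B) g"
    define r' where "r' = hom_induced p Y N Y A g"
    have eh: "e \<in> hom ?G ?H" by (simp add: e_def hom_induced_hom)
    have e': "e' \<in> iso ?G' ?H'" using exc by (simp add: excisive_def e'_def)
    then have surj: "e' ` carrier ?G' = carrier ?H'" by (simp add: iso_def bij_betw_def)
    have cid: "continuous_map (subtopology Y B) Y id" "continuous_map (subtopology Y N') Y id"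
       "continuous_map (subtopology Y B) (subtopology Y N') id" "continuous_map Y Y id"
      using N' by (auto simp: continuous_map_in_subtopology continuous_map_from_subtopology)
    have cg: "continuous_map (subtopology Y N') (subtopology Y B) g"
      using g N' by (auto simp: continuous_map_in_subtopology continuous_map_from_subtopology)
    \<comment> \<open>The homotopy from \<open>id\<close> to \<open>g\<close> runs through maps of
      pairs, so \<open>r\<close> is a left inverse of \<open>i\<close>, and below \<open>r'\<close>
      is one of \<open>i'\<close>.\<close>
    have "homotopic_with (\<lambda>h. h \<in> (A \<inter> B) \<rightarrow> A \<inter> B) (subtopology Y B) (subtopology Y B) id g"
      by (rule homotopic_with_subtopology[OF hom]) blast
    then have ri: "r (i x) = x" if "x \<in> carrier ?G" for x
      using that N N' g cid cg
      unfolding r_def i_def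
      by (subst hom_induced_compose') (auto simp: homology_homotopy_axiom[symmetric] hom_induced_id)
    have "homotopic_with (\<lambda>h. h \<in> A \<rightarrow> A) Y Y id g"
      using hom by (rule homotopic_with_mono) auto
    then have r'i': "r' (i' x) = x" if "x \<in> carrier ?H" for x
      using that N g cid unfolding r'_def i'_def
      by (subst hom_induced_compose') (auto simp: homology_homotopy_axiom[symmetric] hom_induced_id)
    \<comment> \<open>In both squares the two composites are induced by one and the same map,
      \<open>id\<close> in the first and \<open>g\<close> in the second. Injectivity of
      \<open>e\<close> then follows from \<open>sq1\<close>, surjectivity from
      \<open>sq2\<close>.\<close>
    have sq1: "e' (i x) = i' (e x)" for x
      unfolding e_def e'_def i_def i'_def
      using N N' cid by (subst (1 2) hom_induced_compose') auto
    have sq2: "e (r x) = r' (e' x)" for x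
      unfolding e_def e'_def r_def r'_def
      using N N' cid cg g by (subst (1 2) hom_induced_compose') auto
    have ih: "i \<in> hom ?G ?G'" "i' \<in> hom ?H ?H'" "r \<in> hom ?G' ?G" "r' \<in> hom ?H' ?H"
      by (simp_all add: i_def i'_def r_def r'_def hom_induced_hom)
    have "inj_on e (carrier ?G)"
    proof (rule inj_onI)
      fix x y assume xy: "x \<in> carrier ?G" "y \<in> carrier ?G" "e x = e y"
      then have "e' (i x) = e' (i y)" by (simp add: sq1)
      then have "i x = i y" using e' xy ih by (auto simp: iso_def bij_betw_def inj_on_def hom_def Pi_def)
      then show "x = y" by (metis ri xy(1,2))
    qed
    moreover have "e ` carrier ?G = carrier ?H"
    proof
      show "e ` carrier ?G \<subseteq> carrier ?H" using eh by (auto simp: hom_def)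
      show "carrier ?H \<subseteq> e ` carrier ?G"
      proof
        fix y assume y: "y \<in> carrier ?H"
        then have "i' y \<in> carrier ?H'" using ih by (auto simp: hom_def)
        then obtain z where z: "z \<in> carrier ?G'" "e' z = i' y"
          using surj by (metis imageE)
        then have "y = e (r z)" using sq2 r'i' y by simp
        then show "y \<in> e ` carrier ?G" using z ih by (auto simp: hom_def)
      qed
    qed
    ultimately show ?thesis using eh by (simp add: iso_def bij_betw_def flip: e_def)
  qed
  then show ?thesis using Y by (simp add: excisive_def)
qed

text \<open>The homotopy and the neighbourhoods live on all of \<open>X\<close> and are cut down to
  \<open>Y\<close>. Thus one homotopy can serve several subspaces.\<close>

lemma excisive_subtopology:
  assumes hom: "homotopic_with (\<lambda>h. h ` Y \<subseteq> Y \<and> h ` A \<subseteq> A \<and> h ` B \<subseteq> B) X X id g"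
    and Y: "Y \<subseteq> topspace X" "Y \<subseteq> A \<union> B"
    and N: "openin X N" "A \<subseteq> N" "g ` N \<subseteq> A"
    and N': "openin X N'" "B \<subseteq> N'" "g ` N' \<subseteq> B"
  shows "excisive (subtopology X Y) (Y \<inter> A) (Y \<inter> B)"
proof (rule excisive_homotopy)
  show "homotopic_with (\<lambda>h. h ` (Y \<inter> A) \<subseteq> Y \<inter> A \<and> h ` (Y \<inter> B) \<subseteq> Y \<inter> B)
      (subtopology X Y) (subtopology X Y) id g"
    by (rule homotopic_with_subtopology[OF hom]) blast
  have g: "g ` Y \<subseteq> Y"
    using homotopic_with_imp_property[OF hom] by blast
  show "Y \<inter> A \<union> Y \<inter> B = topspace (subtopology X Y)"
    using Y by auto
  show "openin (subtopology X Y) (Y \<inter> N)" "openin (subtopology X Y) (Y \<inter> N')"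
    using N N' by (auto simp: openin_subtopology_Int2)
  show "Y \<inter> A \<subseteq> Y \<inter> N" "Y \<inter> B \<subseteq> Y \<inter> N'" "g ` (Y \<inter> N) \<subseteq> Y \<inter> A" "g ` (Y \<inter> N') \<subseteq> Y \<inter> B"
    using N N' g by blast+
qed

section \<open>The Mayer--Vietoris boundary map\<close>

text \<open>Pass from \<open>Y\<close> to the pair \<open>(Y, A)\<close>, invert excision to reach
  the pair \<open>(B, A \<inter> B)\<close>, then take the boundary. The inverse is meaningful only
  for excisive decompositions.\<close>

definition mv_boundary :: "int \<Rightarrow> 'a topology \<Rightarrow> 'a set \<Rightarrow> 'a set \<Rightarrow> 'a chain set \<Rightarrow> 'a chain set" where
  "mv_boundary p Y A B =
     hom_boundary p (subtopology Y B) (A \<inter> B) \<circ>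
     inv_into (carrier (relative_homology_group p (subtopology Y B) (A \<inter> B)))
       (hom_induced p (subtopology Y B) (A \<inter> B) Y A id) \<circ>
     hom_induced p Y {} Y A id"

lemma inv_into_iso_hom:
  assumes "h \<in> iso G H" "group G"
  shows "inv_into (carrier G) h \<in> hom H G"
  using group.iso_set_sym[OF assms(2) assms(1)] by (auto simp: iso_def)

lemma mv_boundary_hom:
  assumes "excisive Y A B"
  shows "mv_boundary p Y A B \<in> hom (homology_group p Y) (homology_group (p-1) (subtopology Y (A \<inter> B)))"
proof -
  have "subtopology (subtopology Y B) (A \<inter> B) = subtopology Y (A \<inter> B)"
    by (simp add: subtopology_subtopology inf.absorb2)
  then have "hom_boundary p (subtopology Y B) (A \<inter> B) \<in>
     hom (relative_homology_group p (subtopology Y B) (A \<inter> B)) (homology_group (p-1) (subtopology Y (A \<inter> B)))"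
    using hom_boundary_hom[of p "subtopology Y B" "A \<inter> B"] by simp
  moreover have "inv_into (carrier (relative_homology_group p (subtopology Y B) (A \<inter> B)))
       (hom_induced p (subtopology Y B) (A \<inter> B) Y A id)
     \<in> hom (relative_homology_group p Y A) (relative_homology_group p (subtopology Y B) (A \<inter> B))"
    using assms by (intro inv_into_iso_hom) (auto simp: excisive_def)
  ultimately show ?thesis
    unfolding mv_boundary_def by (auto intro: hom_compose[OF hom_induced_hom hom_compose])
qed

text \<open>Excision is injective, so any lift \<open>z\<close> of \<open>x\<close> is the one
  chosen by \<open>inv_into\<close>. Later arguments choose convenient lifts and avoid the
  inverse.\<close>

lemma mv_boundary_eq:
  assumes "excisive Y A B" "z \<in> carrier (relative_homology_group p (subtopology Y B) (A \<inter> B))"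
    "hom_induced p (subtopology Y B) (A \<inter> B) Y A id z = hom_induced p Y {} Y A id x"
  shows "mv_boundary p Y A B x = hom_boundary p (subtopology Y B) (A \<inter> B) z"
  using assms by (auto simp: mv_boundary_def excisive_def iso_def bij_betw_def simp flip: assms(3))

lemma mv_boundary_lift:
  assumes "excisive Y A B" "x \<in> carrier (homology_group p Y)"
  obtains z where "z \<in> carrier (relative_homology_group p (subtopology Y B) (A \<inter> B))"
    "hom_induced p (subtopology Y B) (A \<inter> B) Y A id z = hom_induced p Y {} Y A id x"
proof -
  have "hom_induced p Y {} Y A id x \<in> carrier (relative_homology_group p Y A)"
    using hom_induced_hom assms(2) by (rule hom_in_carrier)
  moreover have "hom_induced p (subtopology Y B) (A \<inter> B) Y A id `
      carrier (relative_homology_group p (subtopology Y B) (A \<inter> B)) = carrier (relative_homology_group p Y A)"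
    using assms(1) by (simp add: excisive_def iso_def bij_betw_def)
  ultimately show ?thesis
    using that by (metis imageE)
qed

text \<open>If \<open>z\<close> lifts \<open>x\<close>, then the image of \<open>z\<close> under
  \<open>f\<close> lifts the image of \<open>x\<close>; naturality of the boundary of a pair does
  the rest.\<close>

lemma mv_boundary_natural:
  assumes "excisive Y A B" "excisive Y' A' B'" "x \<in> carrier (homology_group p Y)"
    and f: "continuous_map Y Y' f" "f \<in> A \<rightarrow> A'" "f \<in> B \<rightarrow> B'"
  shows "hom_induced (p-1) (subtopology Y (A \<inter> B)) {} (subtopology Y' (A' \<inter> B')) {} f (mv_boundary p Y A B x)
       = mv_boundary p Y' A' B' (hom_induced p Y {} Y' {} f x)"
proof -
  obtain z where z: "z \<in> carrier (relative_homology_group p (subtopology Y B) (A \<inter> B))"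
    "hom_induced p (subtopology Y B) (A \<inter> B) Y A id z = hom_induced p Y {} Y A id x"
    using mv_boundary_lift assms by blast
  let ?f = "hom_induced p (subtopology Y B) (A \<inter> B) (subtopology Y' B') (A' \<inter> B') f"
  have c: "continuous_map (subtopology Y B) (subtopology Y' B') f"
    "continuous_map (subtopology Y B) Y id" "continuous_map (subtopology Y' B') Y' id"
    using f by (auto simp: continuous_map_in_subtopology continuous_map_from_subtopology)
  have fz: "?f z \<in> carrier (relative_homology_group p (subtopology Y' B') (A' \<inter> B'))"
    using hom_induced_hom z(1) by (rule hom_in_carrier)
  have "hom_induced p (subtopology Y' B') (A' \<inter> B') Y' A' id (?f z) =
     hom_induced p Y A Y' A' f (hom_induced p (subtopology Y B) (A \<inter> B) Y A id z)"
    using f c by (subst (1 2) hom_induced_compose') auto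
  also have "\<dots> = hom_induced p Y' {} Y' A' id (hom_induced p Y {} Y' {} f x)"
    unfolding z(2) using f c by (subst (1 2) hom_induced_compose') auto
  finally have "mv_boundary p Y' A' B' (hom_induced p Y {} Y' {} f x) =
     hom_boundary p (subtopology Y' B') (A' \<inter> B') (?f z)"
    by (rule mv_boundary_eq[OF assms(2) fz])
  also have "\<dots> = hom_induced (p-1) (subtopology (subtopology Y B) (A \<inter> B)) {}
      (subtopology (subtopology Y' B') (A' \<inter> B')) {} f (hom_boundary p (subtopology Y B) (A \<inter> B) z)"
    using naturality_hom_induced[OF c(1), of "A \<inter> B" "A' \<inter> B'" p] f by (auto simp: fun_eq_iff)
  finally show ?thesis
    using mv_boundary_eq[OF assms(1) z] by (simp add: subtopology_subtopology inf.absorb2)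
qed

text \<open>A lift \<open>z\<close> with trivial boundary comes from the homology of
  \<open>B\<close>, hence is trivial. So \<open>x\<close> dies in the pair \<open>(Y, A)\<close> and
  comes from the homology of \<open>A\<close>, which is trivial too.\<close>

lemma mv_boundary_inj:
  assumes ex: "excisive Y A B"
    and triv: "trivial_group (homology_group p (subtopology Y A))"
      "trivial_group (homology_group p (subtopology Y B))"
  shows "inj_on (mv_boundary p Y A B) (carrier (homology_group p Y))"
proof (rule inj_on_hom_trivial[OF _ _ mv_boundary_hom[OF ex]])
  fix x assume x: "x \<in> carrier (homology_group p Y)"
    and 1: "mv_boundary p Y A B x = \<one>\<^bsub>homology_group (p-1) (subtopology Y (A \<inter> B))\<^esub>"
  let ?G = "relative_homology_group p (subtopology Y B) (A \<inter> B)"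
  obtain z where z: "z \<in> carrier ?G"
    "hom_induced p (subtopology Y B) (A \<inter> B) Y A id z = hom_induced p Y {} Y A id x"
    using mv_boundary_lift ex x by blast
  have "hom_boundary p (subtopology Y B) (A \<inter> B) z =
      \<one>\<^bsub>homology_group (p-1) (subtopology (subtopology Y B) (A \<inter> B))\<^esub>"
    using mv_boundary_eq[OF ex z] 1 by (simp add: subtopology_subtopology inf.absorb2)
  then have "z \<in> hom_induced p (subtopology Y B) {} (subtopology Y B) (A \<inter> B) id `
      carrier (homology_group p (subtopology Y B))"
    using homology_exact_relative[OF z(1)] by simp
  then have "z = \<one>\<^bsub>?G\<^esub>"
    using triv(2) by (auto simp: trivial_group_def hom_induced_one)
  then have "hom_induced p Y {} Y A id x = \<one>\<^bsub>relative_homology_group p Y A\<^esub>"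
    using z(2) by (simp add: hom_induced_one)
  then have "x \<in> hom_induced p (subtopology Y A) {} Y {} id ` carrier (homology_group p (subtopology Y A))"
    using homology_exact_space[OF x] by blast
  then show "x = \<one>\<^bsub>homology_group p Y\<^esub>"
    using triv(1) by (auto simp: trivial_group_def hom_induced_one)
qed auto

text \<open>Exactness of the Mayer--Vietoris sequence at the intersection. Dying in \<open>B\<close>
  means being the boundary of some \<open>z\<close>; by naturality, dying in \<open>A\<close> means
  that the excised \<open>z\<close> has trivial boundary and so comes from \<open>Y\<close>.\<close>

lemma mv_boundary_image:
  assumes ex: "excisive Y A B"
  shows "mv_boundary p Y A B ` carrier (homology_group p Y) =
     kernel (homology_group (p-1) (subtopology Y (A \<inter> B))) (homology_group (p-1) (subtopology Y A))
       (hom_induced (p-1) (subtopology Y (A \<inter> B)) {} (subtopology Y A) {} id) \<inter>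
     kernel (homology_group (p-1) (subtopology Y (A \<inter> B))) (homology_group (p-1) (subtopology Y B))
       (hom_induced (p-1) (subtopology Y (A \<inter> B)) {} (subtopology Y B) {} id)"
    (is "?L = ?R")
proof -
  let ?G = "relative_homology_group p (subtopology Y B) (A \<inter> B)"
  let ?d = "hom_boundary p (subtopology Y B) (A \<inter> B)"
  let ?e = "hom_induced p (subtopology Y B) (A \<inter> B) Y A id"
  have [simp]: "subtopology (subtopology Y B) (A \<inter> B) = subtopology Y (A \<inter> B)"
    by (simp add: subtopology_subtopology inf.absorb2)
  have hb: "?d z \<in> carrier (homology_group (p-1) (subtopology Y (A \<inter> B)))" for z
    using hom_boundary_carrier[of p "subtopology Y B" "A \<inter> B" z] by simp
  have nat: "hom_induced (p-1) (subtopology Y (A \<inter> B)) {} (subtopology Y A) {} id (?d z) =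
      hom_boundary p Y A (?e z)" for z
    using naturality_hom_induced[of "subtopology Y B" Y id "A \<inter> B" A p]
    by (auto simp: fun_eq_iff continuous_map_from_subtopology)
  show ?thesis
  proof (intro equalityI subsetI)
    fix w assume "w \<in> ?L"
    then obtain x where x: "x \<in> carrier (homology_group p Y)" "w = mv_boundary p Y A B x" by blast
    obtain z where z: "z \<in> carrier ?G" "?e z = hom_induced p Y {} Y A id x"
      using mv_boundary_lift ex x by blast
    have w: "w = ?d z" using mv_boundary_eq[OF ex z] x by simp
    have "hom_induced p Y {} Y A id x \<in> carrier (relative_homology_group p Y A)"
      using hom_induced_hom x(1) by (rule hom_in_carrier)
    then have "hom_boundary p Y A (hom_induced p Y {} Y A id x) = \<one>\<^bsub>homology_group (p-1) (subtopology Y A)\<^esub>"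
      using homology_exact_relative x(1) by blast
    moreover have "hom_induced (p-1) (subtopology Y (A \<inter> B)) {} (subtopology Y B) {} id w
      = \<one>\<^bsub>homology_group (p-1) (subtopology Y B)\<^esub>"
      using homology_exact_subspace[of w p "subtopology Y B" "A \<inter> B"] z hb by (auto simp: w)
    ultimately show "w \<in> ?R" using nat z hb by (simp add: w kernel_def)
  next
    fix w assume w: "w \<in> ?R"
    then obtain z where z: "z \<in> carrier ?G" "w = ?d z"
      using homology_exact_subspace[of w p "subtopology Y B" "A \<inter> B"] by (auto simp: kernel_def)
    have "?e z \<in> carrier (relative_homology_group p Y A)"
      using hom_induced_hom z(1) by (rule hom_in_carrier)
    moreover have "hom_boundary p Y A (?e z) = \<one>\<^bsub>homology_group (p-1) (subtopology Y A)\<^esub>"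
      using w nat[of z] by (simp add: z(2) kernel_def)
    ultimately obtain x where x: "x \<in> carrier (homology_group p Y)" "?e z = hom_induced p Y {} Y A id x"
      using homology_exact_relative by blast
    show "w \<in> ?L" using mv_boundary_eq[OF ex z(1) x(2)] x(1) z(2) by force
  qed
qed

section \<open>Homology of a space glued from three pieces\<close>

text \<open>The algebraic core in an arbitrary degree \<open>p\<close>, with excision and vanishing
  as its only inputs. The isomorphism is the composite \<open>\<delta>D \<circ> \<delta>Z\<close> of
  two Mayer--Vietoris boundaries.\<close>

lemma homology_triad_iso:
  fixes Z :: "'a topology" and V1 V2 V3 :: "'a set"
  defines "S \<equiv> V1 \<inter> V2 \<inter> V3" and "Y \<equiv> V2 \<union> V3" and "D \<equiv> V1 \<inter> (V2 \<union> V3)"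
  assumes exZ: "excisive Z V1 Y" and exY: "excisive (subtopology Z Y) V2 V3"
    and exD: "excisive (subtopology Z D) (V1 \<inter> V2) (V1 \<inter> V3)"
    and V: "\<And>V k. V \<in> {V1, V2, V3} \<Longrightarrow> p - 1 \<le> k \<Longrightarrow> k \<le> p \<Longrightarrow> trivial_group (homology_group k (subtopology Z V))"
    and W: "\<And>W. W \<in> {V1 \<inter> V2, V1 \<inter> V3, V2 \<inter> V3} \<Longrightarrow> trivial_group (homology_group (p - 1) (subtopology Z W))"
  defines "K \<equiv> \<lambda>W. kernel (homology_group (p - 2) (subtopology Z S)) (homology_group (p - 2) (subtopology Z W))
       (hom_induced (p - 2) (subtopology Z S) {} (subtopology Z W) {} id)"
  shows "homology_group p Z \<cong> (homology_group (p - 2) (subtopology Z S))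
     \<lparr>carrier := K (V1 \<inter> V2) \<inter> K (V1 \<inter> V3) \<inter> K (V2 \<inter> V3)\<rparr>"
proof -
  have eqs: "subtopology (subtopology Z Y) V2 = subtopology Z V2"
    "subtopology (subtopology Z Y) V3 = subtopology Z V3"
    "subtopology (subtopology Z Y) (V2 \<inter> V3) = subtopology Z (V2 \<inter> V3)"
    "subtopology Z (V1 \<inter> Y) = subtopology Z D"
    "subtopology (subtopology Z D) (V1 \<inter> V2) = subtopology Z (V1 \<inter> V2)"
    "subtopology (subtopology Z D) (V1 \<inter> V3) = subtopology Z (V1 \<inter> V3)"
    "subtopology (subtopology Z D) (V1 \<inter> V2 \<inter> (V1 \<inter> V3)) = subtopology Z S"
    by (auto simp: subtopology_subtopology S_def Y_def D_def intro!: arg_cong[of _ _ "subtopology Z"])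
  define \<delta>Z where "\<delta>Z = mv_boundary p Z V1 Y"
  define \<delta>Y where "\<delta>Y = mv_boundary (p - 1) (subtopology Z Y) V2 V3"
  define \<delta>D where "\<delta>D = mv_boundary (p - 1) (subtopology Z D) (V1 \<inter> V2) (V1 \<inter> V3)"
  define j where "j = hom_induced (p - 1) (subtopology Z D) {} (subtopology Z Y) {} id"
  define i where "i = hom_induced (p - 2) (subtopology Z S) {} (subtopology Z (V2 \<inter> V3)) {} id"
  let ?HZ = "homology_group p Z" and ?HD = "homology_group (p - 1) (subtopology Z D)"
    and ?HY = "homology_group (p - 1) (subtopology Z Y)" and ?HS = "homology_group (p - 2) (subtopology Z S)"
    and ?HW = "homology_group (p - 2) (subtopology Z (V2 \<inter> V3))"
  \<comment> \<open>Degree \<open>p\<close> of \<open>Y\<close> embeds by its Mayer--Vietoris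
    boundary into degree \<open>p - 1\<close> of \<open>V2 \<inter> V3\<close>, which
    vanishes.\<close>
  have "trivial_group (homology_group p (subtopology Z Y))"
    using trivial_group_inj_hom[OF mv_boundary_hom[OF exY] mv_boundary_inj[OF exY], of p] V W
    by (simp add: eqs)
  then have injZ: "inj_on \<delta>Z (carrier ?HZ)"
    unfolding \<delta>Z_def using V[of V1 p] by (intro mv_boundary_inj[OF exZ]) simp_all
  have injY: "inj_on \<delta>Y (carrier ?HY)"
    unfolding \<delta>Y_def by (intro mv_boundary_inj[OF exY]) (auto simp: eqs intro!: V)
  have injD: "inj_on \<delta>D (carrier ?HD)"
    unfolding \<delta>D_def by (intro mv_boundary_inj[OF exD]) (auto simp: eqs intro!: W)
  have p2: "p - 1 - 1 = p - 2" by simp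
  have homZ: "\<delta>Z \<in> hom ?HZ ?HD"
    using mv_boundary_hom[OF exZ, of p] by (simp add: \<delta>Z_def eqs)
  have homD: "\<delta>D \<in> hom ?HD ?HS"
    using mv_boundary_hom[OF exD, of "p - 1"] by (simp add: \<delta>D_def eqs p2)
  have homY: "\<delta>Y \<in> hom ?HY ?HW"
    using mv_boundary_hom[OF exY, of "p - 1"] by (simp add: \<delta>Y_def eqs p2)
  have homj: "j \<in> hom ?HD ?HY" unfolding j_def by (rule hom_induced_hom)
  \<comment> \<open>The kernel towards \<open>V1\<close> is the whole group, so in the image of
    \<open>\<delta>Z\<close> only the condition towards \<open>Y\<close> remains.\<close>
  have V1_triv: "w \<in> kernel ?HD (homology_group (p - 1) (subtopology Z V1))
      (hom_induced (p - 1) (subtopology Z D) {} (subtopology Z V1) {} id)" if "w \<in> carrier ?HD" for w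
  proof -
    have "trivial_group (homology_group (p - 1) (subtopology Z V1))" using V by simp
    then have "hom_induced (p - 1) (subtopology Z D) {} (subtopology Z V1) {} id w =
        \<one>\<^bsub>homology_group (p - 1) (subtopology Z V1)\<^esub>"
      by (rule trivial_group_eq_one[OF _ hom_in_carrier[OF hom_induced_hom that]])
    with that show ?thesis by (simp only: kernel_def mem_Collect_eq)
  qed
  have imZ: "\<delta>Z ` carrier ?HZ = kernel ?HD ?HY j"
    using mv_boundary_image[OF exZ, of p] V1_triv unfolding \<delta>Z_def eqs j_def by (auto simp: kernel_def)
  have imD: "\<delta>D ` carrier ?HD = K (V1 \<inter> V2) \<inter> K (V1 \<inter> V3)"
    using mv_boundary_image[OF exD, of "p - 1"] unfolding \<delta>D_def eqs K_def p2 .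
  \<comment> \<open>The inclusion of \<open>D\<close> into \<open>Y\<close> carries
    \<open>V1 \<inter> V2\<close> into \<open>V2\<close> and \<open>V1 \<inter> V3\<close> into
    \<open>V3\<close>, so it respects the two decompositions.\<close>
  have nat: "i (\<delta>D w) = \<delta>Y (j w)" if "w \<in> carrier ?HD" for w
  proof -
    have "continuous_map (subtopology Z D) (subtopology Z Y) id"
      by (rule continuous_map_into_subtopology) (auto simp: D_def Y_def continuous_map_from_subtopology)
    from mv_boundary_natural[OF exD exY that this] show ?thesis
      unfolding \<delta>D_def \<delta>Y_def i_def j_def eqs p2 by simp
  qed
  \<comment> \<open>Injectivity of \<open>\<delta>Y\<close> moves the question whether
    \<open>w\<close> dies in \<open>Y\<close> down to the surface, where it becomes membership in
    the third kernel.\<close>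
  have ker: "j w = \<one>\<^bsub>?HY\<^esub> \<longleftrightarrow> i (\<delta>D w) = \<one>\<^bsub>?HW\<^esub>" if w: "w \<in> carrier ?HD" for w
  proof -
    have "\<delta>Y (j w) = \<delta>Y \<one>\<^bsub>?HY\<^esub> \<longleftrightarrow> j w = \<one>\<^bsub>?HY\<^esub>"
      using hom_in_carrier[OF homj w] by (intro inj_on_eq_iff[OF injY]) (auto simp: group.is_monoid)
    moreover have "\<delta>Y \<one>\<^bsub>?HY\<^esub> = \<one>\<^bsub>?HW\<^esub>" by (rule hom_one[OF homY]) auto
    ultimately show ?thesis using nat[OF w] by simp
  qed
  have "\<delta>D ` \<delta>Z ` carrier ?HZ = K (V1 \<inter> V2) \<inter> K (V1 \<inter> V3) \<inter> K (V2 \<inter> V3)"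
  proof -
    have "\<delta>D w \<in> K (V2 \<inter> V3) \<longleftrightarrow> w \<in> kernel ?HD ?HY j" if "w \<in> carrier ?HD" for w
      using ker[OF that] that hom_in_carrier[OF homD that] by (simp add: K_def kernel_def i_def)
    then have "\<delta>D ` kernel ?HD ?HY j = \<delta>D ` carrier ?HD \<inter> K (V2 \<inter> V3)"
      by (fastforce simp: kernel_def)
    then show ?thesis by (simp add: imZ imD)
  qed
  moreover have "inj_on (\<delta>D \<circ> \<delta>Z) (carrier ?HZ)"
    using injZ injD hom_in_carrier[OF homZ] by (intro comp_inj_on) (auto intro: inj_on_subset)
  moreover have "\<delta>D \<circ> \<delta>Z \<in> hom ?HZ ?HS"
    by (rule hom_compose[OF homZ homD])
  ultimately have "\<delta>D \<circ> \<delta>Z \<in> iso ?HZ (?HS\<lparr>carrier := K (V1 \<inter> V2) \<inter> K (V1 \<inter> V3) \<inter> K (V2 \<inter> V3)\<rparr>)"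
    by (auto simp: iso_def bij_betw_def hom_def image_comp)
  then show ?thesis by (rule is_isoI)
qed

section \<open>Homology of handlebodies\<close>

definition vanishing_homology :: "int \<Rightarrow> 'a topology \<Rightarrow> bool" where
  "vanishing_homology k X \<longleftrightarrow> (\<forall>p\<ge>k. trivial_group (homology_group p X))"

lemma vanishing_homology_homotopy_equivalent:
  assumes "X homotopy_equivalent_space Y" "vanishing_homology k Y"
  shows "vanishing_homology k X"
  unfolding vanishing_homology_def
proof (intro allI impI)
  fix p assume "k \<le> p"
  then show "trivial_group (homology_group p X)"
    using assms isomorphic_group_triviality[OF homotopy_equivalent_space_imp_isomorphic_homology_groups[of X Y p]]
    by (simp add: vanishing_homology_def)
qed

text \<open>Reduced and unreduced homology agree away from degree 0; this is why \<open>k\<close>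
  must be positive.\<close>

lemma vanishing_homology_contractible:
  assumes "contractible_space X" "0 < k"
  shows "vanishing_homology k X"
  unfolding vanishing_homology_def
proof (intro allI impI)
  fix p assume "k \<le> p"
  then show "trivial_group (homology_group p X)"
    using trivial_reduced_homology_group_contractible_space[OF assms(1), of p] assms(2)
    by (simp add: un_reduced_homology_group)
qed

lemma vanishing_homology_Un:
  assumes "excisive X A B" "vanishing_homology k (subtopology X A)" "vanishing_homology k (subtopology X B)"
    "vanishing_homology (k-1) (subtopology X (A \<inter> B))"
  shows "vanishing_homology k X"
  unfolding vanishing_homology_def
proof (intro allI impI)
  fix p assume "k \<le> p"
  then show "trivial_group (homology_group p X)"
    using assms trivial_group_inj_hom[OF mv_boundary_hom[OF assms(1)] mv_boundary_inj[OF assms(1)], of p]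
    by (simp add: vanishing_homology_def)
qed

text \<open>By excision the homology of \<open>(X, A)\<close> is that of a pair of contractible
  spaces, hence trivial. By the exact sequence, the homology of \<open>A\<close> then injects into
  that of \<open>X\<close>.\<close>

lemma vanishing_homology_excise_contractible:
  assumes ex: "excisive X A B" and "vanishing_homology k X"
    and "contractible_space (subtopology X B)" "contractible_space (subtopology X (A \<inter> B))" "A \<inter> B \<noteq> {}"
  shows "vanishing_homology k (subtopology X A)"
  unfolding vanishing_homology_def
proof (intro allI impI)
  fix p assume "k \<le> p"
  then have X: "trivial_group (homology_group p X)"
    using assms by (simp add: vanishing_homology_def)
  have "trivial_group (relative_homology_group (p+1) (subtopology X B) (A \<inter> B))"
    using assms by (intro trivial_relative_homology_group_contractible_spaces)
      (auto simp: excisive_def subtopology_subtopology inf.absorb2)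
  then have R: "trivial_group (relative_homology_group (p+1) X A)"
    using ex isomorphic_group_triviality[OF is_isoI] unfolding excisive_def
    by (metis group_relative_homology_group)
  have "x = \<one>\<^bsub>homology_group p (subtopology X A)\<^esub>" if x: "x \<in> carrier (homology_group p (subtopology X A))" for x
  proof -
    have "hom_induced p (subtopology X A) {} X {} id x = \<one>\<^bsub>homology_group p X\<^esub>"
      using X hom_in_carrier[OF hom_induced_hom x] by (auto simp: trivial_group_def)
    then have "x \<in> hom_boundary (p+1) X A ` carrier (relative_homology_group (p+1) X A)"
      using homology_exact_subspace[of x "p+1" X A] x by simp
    then show ?thesis
      using R hom_one[OF hom_boundary_hom[of "p+1" X A]] by (auto simp: trivial_group_def)
  qed
  then show "trivial_group (homology_group p (subtopology X A))"
    by (intro trivial_groupI) auto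
qed

section \<open>Boundary punctures and boundary connected sums\<close>

text \<open>The star centre lies in the direction of \<open>a\<close> at distance
  \<open>r / 2\<close>. Along a segment from it the inner product with \<open>a\<close> is positive
  before the far end, so the segment misses the origin.\<close>

lemma starlike_punctured_half_ball:
  fixes a :: "'e::euclidean_space"
  assumes "a \<noteq> 0" "0 < r"
  shows "starlike (ball 0 r \<inter> {x. 0 \<le> a \<bullet> x} - {0})"
  unfolding starlike_def
proof (intro bexI ballI)
  define c where "c = (r / (2 * norm a)) *\<^sub>R a"
  have ac: "0 < a \<bullet> c" "norm c < r"
    using assms by (simp_all add: c_def)
  then show c: "c \<in> ball 0 r \<inter> {x. 0 \<le> a \<bullet> x} - {0}"
    by auto
  fix x assume x: "x \<in> ball 0 r \<inter> {x. 0 \<le> a \<bullet> x} - {0}"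
  have "closed_segment c x \<subseteq> ball 0 r"
    using c x by (intro closed_segment_subset) auto
  moreover have "0 \<le> a \<bullet> y \<and> y \<noteq> 0" if y: "y \<in> closed_segment c x" for y
  proof -
    obtain u where u: "0 \<le> u" "u \<le> 1" "y = (1 - u) *\<^sub>R c + u *\<^sub>R x"
      using y by (auto simp: closed_segment_def)
    have e: "a \<bullet> y = (1 - u) * (a \<bullet> c) + u * (a \<bullet> x)"
      by (simp add: u(3) inner_add_right)
    show ?thesis
    proof (cases "u = 1")
      case True
      then show ?thesis using u x by auto
    next
      case False
      then have "0 < (1 - u) * (a \<bullet> c)" "0 \<le> u * (a \<bullet> x)" using u ac x by auto
      then have "0 < a \<bullet> y" using e by linarith
      then show ?thesis by auto
    qed
  qed
  ultimately show "closed_segment c x \<subseteq> ball 0 r \<inter> {x. 0 \<le> a \<bullet> x} - {0}"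
    by auto
qed

text \<open>Take the punctured space and the chart domain \<open>U\<close> as the open cover:
  \<open>U\<close> and its punctured copy are contractible. A puncture at an interior point would
  leave a punctured ball, which is not contractible.\<close>

lemma vanishing_homology_puncture:
  fixes \<phi> :: "'a \<Rightarrow> 'e::euclidean_space"
  assumes X: "Hausdorff_space X" "vanishing_homology k X"
    and U: "openin X U" "homeomorphic_map (subtopology X U) (top_of_set (\<phi> ` U)) \<phi>"
    and img: "\<phi> ` U = ball 0 r \<inter> {x. 0 \<le> a \<bullet> x}" "a \<noteq> 0" "0 < r"
  shows "vanishing_homology k (subtopology X (topspace X - {inv_into U \<phi> 0}))"
proof -
  let ?p = "inv_into U \<phi> 0"
  have UX: "U \<subseteq> topspace X" using U openin_subset by blast
  have inj: "inj_on \<phi> U"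
    using U(2) UX homeomorphic_imp_injective_map by (fastforce simp: inf.absorb2)
  have 0: "0 \<in> \<phi> ` U" using img by simp
  have p: "?p \<in> U" "\<phi> ?p = 0"
    using inv_into_into[OF 0] f_inv_into_f[OF 0] by auto
  have im: "\<phi> ` (U - {?p}) = \<phi> ` U - {0}"
    using inj_on_image_set_diff[OF inj, of U "{?p}"] p by simp
  have "homeomorphic_map (subtopology (subtopology X U) (U - {?p}))
      (subtopology (top_of_set (\<phi> ` U)) (\<phi> ` U - {0})) \<phi>"
    using UX im by (intro homeomorphic_map_subtopologies[OF U(2)]) (auto simp: inf.absorb2)
  then have "subtopology X (U - {?p}) homeomorphic_space top_of_set (\<phi> ` U - {0})"
    by (metis homeomorphic_map_imp_homeomorphic_space subtopology_subtopology inf.absorb2 Diff_subset)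
  moreover have st: "starlike (\<phi> ` U - {0})"
    using img starlike_punctured_half_ball by simp
  ultimately have c1: "contractible_space (subtopology X (U - {?p}))"
    by (metis homeomorphic_space_contractibility starlike_imp_contractible contractible_space_top_of_set)
  have "convex (\<phi> ` U)"
    unfolding img by (intro convex_Int convex_ball) (simp add: convex_halfspace_ge)
  then have c2: "contractible_space (subtopology X U)"
    using homeomorphic_space_contractibility[OF homeomorphic_map_imp_homeomorphic_space[OF U(2)]]
      convex_imp_contractible by auto
  have eq: "(topspace X - {?p}) \<inter> U = U - {?p}" using UX by blast
  have "closedin X {?p}"
    using X(1) p UX Hausdorff_imp_t1_space closedin_t1_singleton by fastforce
  then have ex: "excisive X (topspace X - {?p}) U"
    using U(1) p UX by (intro excisive_open) auto
  have "U - {?p} \<noteq> {}" using im st by (auto simp: starlike_def)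
  then show ?thesis
    using vanishing_homology_excise_contractible[OF ex X(2)] c1 c2 by (simp add: eq)
qed

lemma mtop_submfd [simp]: "mtop (submfd X S) = subtopology (mtop X) S"
  by (simp add: submfd_def)

lemma diffeomorphism_homeomorphic_map:
  "diffeomorphism M N f \<Longrightarrow> homeomorphic_map (mtop M) (mtop N) f"
  unfolding diffeomorphism_def smooth_map_def homeomorphic_map_maps homeomorphic_maps_def by blast

text \<open>
  A puncture at a boundary point does not change the homology, because both a half ball and a half ball
  without its centre are starlike. The two punctured summands overlap in such a punctured half ball.
\<close>

lemma vanishing_homology_glued_sum:
  fixes M1 :: "('a, 'e::euclidean_space) mfd" and M2 :: "('b, 'e) mfd" and M :: "('c, 'e) mfd"
  assumes gs: "glued_sum a M1 M2 M" and a: "a \<noteq> 0" and k: "2 \<le> k"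
    and v: "vanishing_homology k (mtop M1)" "vanishing_homology k (mtop M2)"
  shows "vanishing_homology k (mtop M)"
proof -
  define H where "H = {x. 0 \<le> a \<bullet> x}"
  obtain U1 \<phi>1 U2 \<phi>2 f1 f2 O1 O2 where *:
    "let H = {x. 0 \<le> a \<bullet> x};
            i1 = inv_into U1 \<phi>1; i2 = inv_into U2 \<phi>2;
            P1 = topspace (mtop M1) - {i1 0}; P2 = topspace (mtop M2) - {i2 0}
        in (U1, \<phi>1) \<in> max_atlas M1 \<and> \<phi>1 ` U1 = ball 0 2 \<inter> H \<and>
           (U2, \<phi>2) \<in> max_atlas M2 \<and> \<phi>2 ` U2 = ball 0 2 \<inter> H \<and>
           openin (mtop M) O1 \<and> openin (mtop M) O2 \<and> O1 \<union> O2 = topspace (mtop M) \<and>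
           diffeomorphism (submfd M1 P1 :: ('a, 'e) mfd) (submfd M O1 :: ('c, 'e) mfd) f1 \<and>
           diffeomorphism (submfd M2 P2 :: ('b, 'e) mfd) (submfd M O2 :: ('c, 'e) mfd) f2 \<and>
           (\<forall>q1\<in>P1. \<forall>q2\<in>P2. f1 q1 = f2 q2 \<longleftrightarrow>
              (\<exists>r u. 0 < r \<and> r < 1 \<and> norm u = 1 \<and> u \<in> H \<and>
                     q1 = i1 (r *\<^sub>R u) \<and> q2 = i2 ((1 - r) *\<^sub>R u)))"
    using gs unfolding glued_sum_def by (elim conjE exE)
  define i1 i2 where i: "i1 = inv_into U1 \<phi>1" "i2 = inv_into U2 \<phi>2"
  define P1 P2 where P: "P1 = topspace (mtop M1) - {i1 0}" "P2 = topspace (mtop M2) - {i2 0}"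
  have ch: "(U1, \<phi>1) \<in> max_atlas M1" "(U2, \<phi>2) \<in> max_atlas M2"
    and im1: "\<phi>1 ` U1 = ball 0 2 \<inter> H" and im2: "\<phi>2 ` U2 = ball 0 2 \<inter> H"
    and op: "openin (mtop M) O1" "openin (mtop M) O2" "O1 \<union> O2 = topspace (mtop M)"
    and d1: "diffeomorphism (submfd M1 P1 :: ('a, 'e) mfd) (submfd M O1 :: ('c, 'e) mfd) f1"
    and d2: "diffeomorphism (submfd M2 P2 :: ('b, 'e) mfd) (submfd M O2 :: ('c, 'e) mfd) f2"
    and ov: "\<forall>q1\<in>P1. \<forall>q2\<in>P2. f1 q1 = f2 q2 \<longleftrightarrow>
              (\<exists>r u. 0 < r \<and> r < 1 \<and> norm u = 1 \<and> u \<in> H \<and>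
                     q1 = i1 (r *\<^sub>R u) \<and> q2 = i2 ((1 - r) *\<^sub>R u))"
    using *[unfolded Let_def, folded i, folded P H_def] by - (elim conjE, assumption)+
  have haus: "Hausdorff_space (mtop M1)" "Hausdorff_space (mtop M2)"
    using gs by (auto simp: glued_sum_def smooth_manifold_def)
  have U: "openin (mtop M1) U1" "homeomorphic_map (subtopology (mtop M1) U1) (top_of_set (\<phi>1 ` U1)) \<phi>1"
    "openin (mtop M2) U2" "homeomorphic_map (subtopology (mtop M2) U2) (top_of_set (\<phi>2 ` U2)) \<phi>2"
    using ch by (auto simp: max_atlas_def is_chart_def)
  have h1: "homeomorphic_map (subtopology (mtop M1) P1) (subtopology (mtop M) O1) f1"
    and h2: "homeomorphic_map (subtopology (mtop M2) P2) (subtopology (mtop M) O2) f2"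
    using d1 d2 diffeomorphism_homeomorphic_map by fastforce+
  have "vanishing_homology k (subtopology (mtop M1) P1)"
    unfolding P i using U im1 a haus v unfolding H_def
    by (intro vanishing_homology_puncture[where r=2 and a=a]) auto
  then have v1: "vanishing_homology k (subtopology (mtop M) O1)"
    using h1 homeomorphic_map_imp_homeomorphic_space homeomorphic_imp_homotopy_equivalent_space
      homeomorphic_space_sym vanishing_homology_homotopy_equivalent by metis
  have "vanishing_homology k (subtopology (mtop M2) P2)"
    unfolding P i using U im2 a haus v unfolding H_def
    by (intro vanishing_homology_puncture[where r=2 and a=a]) auto
  then have v2: "vanishing_homology k (subtopology (mtop M) O2)"
    using h2 homeomorphic_map_imp_homeomorphic_space homeomorphic_imp_homotopy_equivalent_space
      homeomorphic_space_sym vanishing_homology_homotopy_equivalent by metis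
  have sub: "U1 \<subseteq> topspace (mtop M1)" "U2 \<subseteq> topspace (mtop M2)" "P1 \<subseteq> topspace (mtop M1)"
    "P2 \<subseteq> topspace (mtop M2)" "O1 \<subseteq> topspace (mtop M)" "O2 \<subseteq> topspace (mtop M)"
    using U op openin_subset P by blast+
  have fO: "f1 ` P1 = O1" "f2 ` P2 = O2"
    using homeomorphic_imp_surjective_map[OF h1] homeomorphic_imp_surjective_map[OF h2] sub
    by (simp_all add: inf.absorb2)
  \<comment> \<open>The overlap read in the first chart: the points \<open>r *\<^sub>R u\<close>
    with \<open>0 < r < 1\<close>. Hence radius 1, although the chart has radius 2.\<close>
  define D where "D = ball 0 1 \<inter> H - {0::'e}"
  have sc: "c *\<^sub>R u \<in> H" if "0 \<le> c" "u \<in> H" for c u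
    using that by (simp add: H_def)
  have D1: "D \<subseteq> \<phi>1 ` U1" using im1 by (auto simp: D_def)
  have i10: "0 \<in> \<phi>1 ` U1" "0 \<in> \<phi>2 ` U2" unfolding im1 im2 by (auto simp: H_def)
  have "i1 x \<in> U1" if "x \<in> D" for x
    unfolding i by (rule inv_into_into) (use D1 that in blast)
  then have iD: "i1 ` D \<subseteq> U1" by blast
  have \<phi>i: "\<phi>1 (i1 x) = x" if "x \<in> \<phi>1 ` U1" for x
    unfolding i using that by (rule f_inv_into_f)
  have \<phi>i2: "\<phi>2 (i2 x) = x" if "x \<in> \<phi>2 ` U2" for x
    unfolding i using that by (rule f_inv_into_f)
  have "i1 x \<noteq> i1 0" if "x \<in> D" for x
  proof
    assume "i1 x = i1 0"
    moreover have "x \<in> \<phi>1 ` U1" using D1 that by blast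
    ultimately have "x = 0" using \<phi>i i10(1) by metis
    then show False using that by (simp add: D_def)
  qed
  then have iP: "i1 ` D \<subseteq> P1" using iD sub P by auto
  have O12: "O1 \<inter> O2 = f1 ` i1 ` D"
  proof (intro equalityI subsetI)
    fix q assume "q \<in> O1 \<inter> O2"
    then obtain q1 q2 where q: "q1 \<in> P1" "q2 \<in> P2" "q = f1 q1" "f1 q1 = f2 q2"
      using fO by (metis IntD1 IntD2 imageE)
    then obtain r u where "0 < r" "r < 1" "norm u = 1" "u \<in> H" "q1 = i1 (r *\<^sub>R u)"
      using ov by blast
    moreover from this have "r *\<^sub>R u \<in> D" using sc by (auto simp: D_def)
    ultimately show "q \<in> f1 ` i1 ` D" using q by blast
  next
    fix q assume "q \<in> f1 ` i1 ` D"
    then obtain x where x: "x \<in> D" "q = f1 (i1 x)" by blast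
    \<comment> \<open>Polar coordinates of \<open>x\<close>. Since \<open>1 - r\<close> also lies
      strictly between 0 and 1, the partner point in the second summand is not its puncture.\<close>
    define r where "r = norm x"
    define u where "u = x /\<^sub>R r"
    have r: "0 < r" "r < 1" "norm u = 1" "u \<in> H" "x = r *\<^sub>R u"
      using x sc by (auto simp: D_def r_def u_def)
    have y: "(1 - r) *\<^sub>R u \<in> \<phi>2 ` U2" "(1 - r) *\<^sub>R u \<noteq> 0" unfolding im2 using r sc by auto
    then have "i2 ((1 - r) *\<^sub>R u) \<in> P2"
      using inv_into_into[OF y(1)] sub P \<phi>i2[OF y(1)] \<phi>i2[OF i10(2)] unfolding i by force
    moreover have "i1 x \<in> P1" using iP x by blast
    ultimately have "f1 (i1 x) = f2 (i2 ((1 - r) *\<^sub>R u))"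
      using ov r by blast
    then show "q \<in> O1 \<inter> O2"
      using \<open>i2 ((1 - r) *\<^sub>R u) \<in> P2\<close> \<open>i1 x \<in> P1\<close> fO x(2) by (metis IntI imageI)
  qed
  have "topspace (subtopology (mtop M1) P1) \<inter> i1 ` D = i1 ` D"
    "topspace (subtopology (mtop M) O1) \<inter> (O1 \<inter> O2) = O1 \<inter> O2"
    using iP sub by auto
  then have "homeomorphic_map (subtopology (subtopology (mtop M1) P1) (i1 ` D))
     (subtopology (subtopology (mtop M) O1) (O1 \<inter> O2)) f1"
    by (intro homeomorphic_map_subtopologies[OF h1]) (simp only: O12)
  then have e1: "subtopology (mtop M1) (i1 ` D) homeomorphic_space subtopology (mtop M) (O1 \<inter> O2)"
    using iP by (metis homeomorphic_map_imp_homeomorphic_space subtopology_subtopology inf.absorb2 inf_le1)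
  have "\<phi>1 ` i1 ` D = D" using \<phi>i D1 by (force simp: image_image)
  then have "homeomorphic_map (subtopology (subtopology (mtop M1) U1) (i1 ` D))
     (subtopology (top_of_set (\<phi>1 ` U1)) D) \<phi>1"
    using iD sub D1 by (intro homeomorphic_map_subtopologies[OF U(2)]) (auto simp: inf.absorb2)
  then have e2: "subtopology (mtop M1) (i1 ` D) homeomorphic_space top_of_set D"
    using iD D1 by (metis homeomorphic_map_imp_homeomorphic_space subtopology_subtopology inf.absorb2)
  have "contractible D"
    using a starlike_imp_contractible starlike_punctured_half_ball[of a 1] by (simp add: D_def H_def)
  then have "contractible_space (subtopology (mtop M) (O1 \<inter> O2))"
    using e1 e2 homeomorphic_space_contractibility contractible_space_top_of_set by metis
  \<comment> \<open>Here \<open>2 \<le> k\<close> enters: degree 0 of a contractible space has to be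
    avoided.\<close>
  then have "vanishing_homology (k-1) (subtopology (mtop M) (O1 \<inter> O2))"
    using k by (intro vanishing_homology_contractible) auto
  then show ?thesis
    using v1 v2 vanishing_homology_Un[OF excisive_open[OF op]] by blast
qed

section \<open>Handlebodies as iterated boundary connected sums\<close>

lemma vanishing_homology_boundary_sum_copies:
  fixes N :: "('b, 'e::euclidean_space) mfd" and M :: "('a, 'e) mfd"
  assumes "boundary_sum_copies N n M" "vanishing_homology k (mtop N)" "2 \<le> k"
  shows "vanishing_homology k (mtop M)"
  using assms(1)
proof induction
  case (1 M)
  then have "mtop M homeomorphic_space (top_of_set (cball (0::'e) 1))"
    using diffeomorphism_homeomorphic_map homeomorphic_map_imp_homeomorphic_space
    unfolding diffeomorphic_def by (fastforce simp: euclidean_mfd_def)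
  then have "contractible_space (mtop M)"
    by (metis homeomorphic_space_contractibility convex_imp_contractible convex_cball contractible_space_top_of_set)
  then show ?case using assms(3) by (intro vanishing_homology_contractible) auto
next
  case (2 n M1 M)
  then show ?case
    using assms vanishing_homology_glued_sum unfolding boundary_connected_sum_def by blast
qed

text \<open>The homology of spheres is computed for \<open>nsphere\<close>, whose points are
  sequences of reals. The circle is transported there by a homeomorphism.\<close>

lemma vanishing_homology_circle: "vanishing_homology 2 (top_of_set (sphere (0::real^2) 1))"
proof -
  obtain f :: "(nat \<Rightarrow> real) \<Rightarrow> real^2" and g
    where "homeomorphic_maps (nsphere (2 - 1)) (top_of_set (sphere 0 1 \<inter> span Basis)) f g"
    using homeomorphic_maps_nsphere_euclidean_sphere[of "Basis :: (real^2) set" 2]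
      independent_Basis orthogonal_Basis by (auto simp: norm_Basis)
  then have "top_of_set (sphere (0::real^2) 1) homeomorphic_space nsphere 1"
    using homeomorphic_space_def homeomorphic_space_sym by fastforce
  moreover have "vanishing_homology 2 (nsphere 1)"
    unfolding vanishing_homology_def
  proof (intro allI impI)
    fix p :: int assume "2 \<le> p"
    then show "trivial_group (homology_group p (nsphere 1))"
      using reduced_homology_group_nsphere(2)[of p 1] by (simp add: un_reduced_homology_group)
  qed
  ultimately show ?thesis
    using vanishing_homology_homotopy_equivalent homeomorphic_imp_homotopy_equivalent_space by blast
qed

text \<open>The convex factor is contracted to \<open>c\<close> along straight segments while the
  first factor stays fixed.\<close>

lemma homotopy_equivalent_Times_convex:
  fixes C :: "'b::real_normed_vector set" and S :: "'a::real_normed_vector set"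
  assumes "convex C" "c \<in> C"
  shows "top_of_set (S \<times> C) homotopy_equivalent_space top_of_set S"
  unfolding homotopy_equivalent_space_def
proof (intro exI conjI)
  show "continuous_map (top_of_set (S \<times> C)) (top_of_set S) fst"
    "continuous_map (top_of_set S) (top_of_set (S \<times> C)) (\<lambda>x. (x, c))"
    using assms by (auto intro!: continuous_intros)
  show "homotopic_with (\<lambda>x. True) (top_of_set (S \<times> C)) (top_of_set (S \<times> C)) ((\<lambda>x. (x, c)) \<circ> fst) id"
  proof (rule homotopic_with_linear)
    fix z assume "z \<in> S \<times> C"
    then have "closed_segment ((fst z), c) (fst z, snd z) \<subseteq> {fst z} \<times> C"
      using assms by (intro closed_segment_subset convex_Times) auto
    then show "closed_segment (((\<lambda>x. (x, c)) \<circ> fst) z) (id z) \<subseteq> S \<times> C"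
      using \<open>z \<in> S \<times> C\<close> by auto
  qed (auto intro!: continuous_intros)
  show "homotopic_with (\<lambda>x. True) (top_of_set S) (top_of_set S) (fst \<circ> (\<lambda>x. (x, c))) id"
    by (simp add: o_def id_def)
qed

lemma vanishing_homology_circle_Times_cball:
  "vanishing_homology 2 (top_of_set (sphere (0::real^2) 1 \<times> cball (0::'b::real_normed_vector) 1))"
  using vanishing_homology_circle homotopy_equivalent_Times_convex[of "cball (0::'b) 1" 0]
    vanishing_homology_homotopy_equivalent by fastforce

lemma vanishing_homology_handlebody4:
  assumes "handlebody4 k M"
  shows "vanishing_homology 2 (mtop M)"
  by (rule vanishing_homology_boundary_sum_copies[OF assms[unfolded handlebody4_def]])
    (simp_all add: euclidean_mfd_def vanishing_homology_circle_Times_cball)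

lemma vanishing_homology_handlebody3:
  assumes "handlebody3 k M"
  shows "vanishing_homology 2 (mtop M)"
  by (rule vanishing_homology_boundary_sum_copies[OF assms[unfolded handlebody3_def]])
    (simp_all add: euclidean_mfd_def vanishing_homology_circle_Times_cball)

section \<open>Pushing neighbourhoods of the pieces into the pieces\<close>

text \<open>
  In the charts of \<open>three_sectors\<close>, the three sectors are the zero sets of the nonnegative functions
  \<open>gap 1\<close>, \<open>gap 2\<close>, \<open>gap 3\<close>, the excesses of \<open>0\<close>, \<open>x\<^sub>1\<close>, \<open>x\<^sub>2\<close> over their minimum. The map \<open>push e\<close>
  lowers all three by \<open>e\<close> (but not below \<open>0\<close>), so it maps the \<open>e\<close>-neighbourhood \<open>gap k \<le> e\<close> of a
  sector into this sector, and it preserves each sector.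
\<close>

definition coord3 :: "nat \<Rightarrow> real^4 \<Rightarrow> real" where
  "coord3 k x = (if k = 1 then 0 else if k = 2 then x $ 1 else x $ 2)"

definition gap :: "nat \<Rightarrow> real^4 \<Rightarrow> real" where
  "gap k x = coord3 k x - min 0 (min (x $ 1) (x $ 2))"

definition push :: "real \<Rightarrow> real^4 \<Rightarrow> real^4" where
  "push e x = x +
     (max (gap 2 x - e) 0 - max (gap 1 x - e) 0 - x $ 1) *\<^sub>R axis 1 1 +
     (max (gap 3 x - e) 0 - max (gap 1 x - e) 0 - x $ 2) *\<^sub>R axis 2 1"

lemma push_nth:
  "push e x $ 1 = max (gap 2 x - e) 0 - max (gap 1 x - e) 0"
  "push e x $ 2 = max (gap 3 x - e) 0 - max (gap 1 x - e) 0"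
  by (simp_all add: push_def axis_def)

lemma gap_le_0:
  "gap 1 x \<le> 0 \<longleftrightarrow> 0 \<le> x $ 1 \<and> 0 \<le> x $ 2"
  "gap 2 x \<le> 0 \<longleftrightarrow> x $ 1 \<le> 0 \<and> x $ 1 \<le> x $ 2"
  "gap 3 x \<le> 0 \<longleftrightarrow> x $ 2 \<le> 0 \<and> x $ 2 \<le> x $ 1"
  by (auto simp: gap_def coord3_def min_def)

text \<open>The lowered gaps are nonnegative and one of them is still zero. Such a triple is exactly
  the triple of gaps of the point whose coordinates are the differences to its first entry.\<close>

lemma gap_push:
  assumes "0 \<le> e" "k \<in> {1, 2, 3}"
  shows "gap k (push e x) = max (gap k x - e) 0"
proof -
  let ?f = "\<lambda>k. max (gap k x - e) 0"
  have "gap 1 x = 0 \<or> gap 2 x = 0 \<or> gap 3 x = 0"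
    by (simp add: gap_def coord3_def min_def)
  then have "?f 1 = 0 \<or> ?f 2 = 0 \<or> ?f 3 = 0"
    using assms(1) by auto
  moreover have "0 \<le> ?f 1" "0 \<le> ?f 2" "0 \<le> ?f 3"
    by auto
  moreover have "min 0 (min (b - a) (c - a)) = - a"
    if "a = 0 \<or> b = 0 \<or> c = 0" "0 \<le> a" "0 \<le> b" "0 \<le> c" for a b c :: real
    using that by (auto simp: min_def)
  ultimately have "min 0 (min (?f 2 - ?f 1) (?f 3 - ?f 1)) = - ?f 1"
    by blast
  moreover have "coord3 k (push e x) = ?f k - ?f 1"
    using assms(2) by (auto simp: coord3_def push_nth)
  ultimately show ?thesis
    by (simp add: gap_def[of k "push e x"] push_nth)
qed

text \<open>Each coordinate is a difference of two gaps, and each gap drops by an amount between 0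
  and \<open>e\<close>; so each of the two coordinates moves by at most \<open>e\<close>.\<close>

lemma dist_push:
  assumes "0 \<le> e"
  shows "dist (push e x) x \<le> 2 * e"
proof -
  define c1 where "c1 = max (gap 2 x - e) 0 - max (gap 1 x - e) 0 - x $ 1"
  define c2 where "c2 = max (gap 3 x - e) 0 - max (gap 1 x - e) 0 - x $ 2"
  have f: "\<bar>max (b - e) 0 - max (a - e) 0 - (b - a)\<bar> \<le> e" if "0 \<le> a" "0 \<le> b" for a b
    using that assms by (auto simp: max_def)
  have "0 \<le> gap k x" if "k \<in> {1, 2, 3}" for k
    using that by (auto simp: gap_def coord3_def)
  moreover have "x $ 1 = gap 2 x - gap 1 x" "x $ 2 = gap 3 x - gap 1 x"
    by (simp_all add: gap_def coord3_def)
  ultimately have "\<bar>c1\<bar> \<le> e" "\<bar>c2\<bar> \<le> e"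
    unfolding c1_def c2_def using f[of "gap 1 x" "gap 2 x"] f[of "gap 1 x" "gap 3 x"] by simp_all
  moreover have "dist (push e x) x = norm (c1 *\<^sub>R axis 1 1 + c2 *\<^sub>R axis 2 1 :: real^4)"
    by (simp add: push_def dist_norm c1_def c2_def)
  moreover have "\<dots> \<le> \<bar>c1\<bar> + \<bar>c2\<bar>"
    by (rule order_trans[OF norm_triangle_ineq]) simp
  ultimately show ?thesis by linarith
qed

lemma push_0: "push 0 x = x"
  using dist_push[of 0 x] by simp

lemma continuous_on_gap [continuous_intros]:
  "continuous_on A f \<Longrightarrow> continuous_on A (\<lambda>x. gap k (f x))"
  unfolding gap_def coord3_def by (cases "k = 1"; cases "k = 2") (auto intro!: continuous_intros)

lemma continuous_on_push [continuous_intros]: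
  "continuous_on A f \<Longrightarrow> continuous_on A e \<Longrightarrow> continuous_on A (\<lambda>x. push (e x) (f x))"
  unfolding push_def by (intro continuous_intros)

section \<open>From pushes in a chart to a homotopy of the whole space\<close>

text \<open>\<open>push\<close> is applied in the chart with a strength that depends on the point
  and fades to zero at the edge of a ball around \<open>p\<close>, so that it extends by the
  identity.\<close>

lemma local_push:
  fixes \<phi> :: "'a \<Rightarrow> real^4" and V :: "nat \<Rightarrow> 'a set"
  assumes X: "Hausdorff_space X" and U: "openin X U"
    and hom: "homeomorphic_map (subtopology X U) (top_of_set (\<phi> ` U)) \<phi>"
    and op: "open (\<phi> ` U)" and p: "p \<in> U"
    and V: "\<And>k q. k \<in> {1, 2, 3} \<Longrightarrow> q \<in> U \<Longrightarrow> q \<in> V k \<longleftrightarrow> gap k (\<phi> q) \<le> 0"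
  obtains g D where "openin X D" "p \<in> D"
    "homotopic_with (\<lambda>h. \<forall>k\<in>{1, 2, 3}. h ` V k \<subseteq> V k) X X id g"
    "\<And>q. q \<notin> D \<Longrightarrow> g q = q"
    "\<And>k q. k \<in> {1, 2, 3} \<Longrightarrow> q \<in> D \<inter> V k \<Longrightarrow> \<exists>N. openin X N \<and> q \<in> N \<and> g ` N \<subseteq> V k"
proof -
  have UX: "U \<subseteq> topspace X" using U openin_subset by blast
  obtain \<psi> where maps: "homeomorphic_maps (subtopology X U) (top_of_set (\<phi> ` U)) \<phi> \<psi>"
    using hom homeomorphic_map_maps by blast
  then have c\<phi>: "continuous_map (subtopology X U) (top_of_set (\<phi> ` U)) \<phi>"
    and c\<psi>: "continuous_map (top_of_set (\<phi> ` U)) (subtopology X U) \<psi>"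
    and \<psi>\<phi>: "\<And>q. q \<in> U \<Longrightarrow> \<psi> (\<phi> q) = q" and \<phi>\<psi>: "\<And>x. x \<in> \<phi> ` U \<Longrightarrow> \<phi> (\<psi> x) = x"
    using UX by (auto simp: homeomorphic_maps_def)
  have \<psi>U: "\<psi> x \<in> U" if "x \<in> \<phi> ` U" for x
    using that \<psi>\<phi> by auto
  define c where "c = \<phi> p"
  obtain r where r: "0 < r" "cball c r \<subseteq> \<phi> ` U"
    using op p open_contains_cball c_def by (metis imageI)
  \<comment> \<open>Half the distance to the edge of the ball: by \<open>dist_push\<close> a point
    moves at most twice its strength, so it stays in \<open>cball c r\<close> and thus in the chart
    image.\<close>
  define \<epsilon> where "\<epsilon> x = max 0 (r - dist x c) / 2" for x
  have \<epsilon>0: "0 \<le> \<epsilon> x" for x by (simp add: \<epsilon>_def)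
  have \<epsilon>_out: "\<epsilon> x = 0" if "r \<le> dist x c" for x using that by (simp add: \<epsilon>_def)
  have \<epsilon>_in: "0 < \<epsilon> x" if "dist x c < r" for x using that by (simp add: \<epsilon>_def)
  have F: "push (t * \<epsilon> x) x \<in> \<phi> ` U" if "x \<in> \<phi> ` U" "t \<in> {0..1}" for t x
  proof (cases "r \<le> dist x c")
    case True
    then show ?thesis using that by (simp add: \<epsilon>_out push_0)
  next
    case False
    have "dist (push (t * \<epsilon> x) x) x \<le> 2 * (t * \<epsilon> x)"
      using that \<epsilon>0[of x] by (intro dist_push) simp
    also have "\<dots> \<le> 2 * \<epsilon> x"
      using that \<epsilon>0[of x] by (simp add: mult_left_le_one_le)
    also have "\<dots> = r - dist x c" using False by (simp add: \<epsilon>_def)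
    finally have "dist (push (t * \<epsilon> x) x) c \<le> r"
      using dist_triangle[of "push (t * \<epsilon> x) x" c x] by simp
    then show ?thesis using r by (auto simp: dist_commute)
  qed
  define H where "H z = (if snd z \<in> U then \<psi> (push (fst z * \<epsilon> (\<phi> (snd z))) (\<phi> (snd z))) else snd z)" for z
  define D where "D = {q \<in> topspace (subtopology X U). \<phi> q \<in> \<phi> ` U \<inter> ball c r}"
  have "openin (subtopology X U) D"
    unfolding D_def by (rule openin_continuous_map_preimage[OF c\<phi>]) auto
  then have opD: "openin X D" using U openin_trans_full by blast
  have D_iff: "q \<in> D \<longleftrightarrow> q \<in> U \<and> dist (\<phi> q) c < r" for q
    using UX by (auto simp: D_def dist_commute)
  have H_out: "H (t, q) = q" if "q \<notin> D" for t q
    using that \<psi>\<phi> by (simp add: H_def D_iff \<epsilon>_out push_0 not_less)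
  have H_in: "H (t, q) \<in> U" "\<phi> (H (t, q)) = push (t * \<epsilon> (\<phi> q)) (\<phi> q)" if "q \<in> U" "t \<in> {0..1}" for t q
    using that F[of "\<phi> q" t] \<psi>U \<phi>\<psi> by (auto simp: H_def)
  have gapH: "gap k (\<phi> (H (t, q))) = max (gap k (\<phi> q) - t * \<epsilon> (\<phi> q)) 0"
    if "q \<in> U" "t \<in> {0..1}" "k \<in> {1, 2, 3}" for t q k
    using that H_in \<epsilon>0 by (simp only: H_in(2)) (intro gap_push; simp)
  \<comment> \<open>A compact set between \<open>D\<close> and \<open>U\<close>, closed because
    \<open>X\<close> is Hausdorff. Its complement together with \<open>U\<close> is an open cover,
    on which \<open>H\<close> is pasted from the push and the identity; the two agree outside
    \<open>D\<close>.\<close>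
  define C where "C = \<psi> ` cball c r"
  have "compactin (top_of_set (\<phi> ` U)) (cball c r)"
    using r by (simp add: compactin_subtopology)
  then have "compactin (subtopology X U) C"
    unfolding C_def using c\<psi> by (rule image_compactin)
  then have "closedin X C"
    using X compactin_imp_closedin compactin_subtopology by blast
  have DC: "q \<in> C" if "q \<in> D" for q
  proof -
    have "q = \<psi> (\<phi> q)" "\<phi> q \<in> cball c r" using that \<psi>\<phi> by (auto simp: D_iff dist_commute)
    then show ?thesis unfolding C_def by blast
  qed
  let ?I = "top_of_set {0..1::real}"
  have cH: "continuous_map (prod_topology ?I X) X H"
  proof (rule pasting_lemma[where I = "UNIV :: bool set"
        and T = "\<lambda>b. {0..1} \<times> (if b then U else topspace X - C)"
        and f = "\<lambda>b. if b then \<psi> \<circ> ((\<lambda>(t, x). push (t * \<epsilon> x) x) \<circ> (\<lambda>(t, q). (t, \<phi> q))) else snd"])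
    fix b :: bool
    show "openin (prod_topology ?I X) ({0..1} \<times> (if b then U else topspace X - C))"
      using U \<open>closedin X C\<close> by (auto simp: openin_prod_Times_iff)
    show "continuous_map (subtopology (prod_topology ?I X) ({0..1} \<times> (if b then U else topspace X - C))) X
        (if b then \<psi> \<circ> ((\<lambda>(t, x). push (t * \<epsilon> x) x) \<circ> (\<lambda>(t, q). (t, \<phi> q))) else snd)"
    proof (cases b)
      case True
      have 1: "continuous_map (prod_topology ?I (subtopology X U)) (prod_topology ?I (top_of_set (\<phi> ` U)))
          (\<lambda>(t, q). (t, \<phi> q))"
        using c\<phi> continuous_map_prod_top[of ?I "subtopology X U" ?I "top_of_set (\<phi> ` U)" "\<lambda>t. t" \<phi>] by simp
      have 2: "continuous_map (prod_topology ?I (top_of_set (\<phi> ` U))) (top_of_set (\<phi> ` U))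
          (\<lambda>(t, x). push (t * \<epsilon> x) x)"
      proof -
        have "continuous_on ({0..1} \<times> \<phi> ` U) (\<lambda>z. push (fst z * \<epsilon> (snd z)) (snd z))"
          unfolding \<epsilon>_def by (intro continuous_intros) auto
        moreover have "push (fst z * \<epsilon> (snd z)) (snd z) \<in> \<phi> ` U" if "z \<in> {0..1} \<times> \<phi> ` U" for z
          using that by (intro F) auto
        ultimately show ?thesis by (auto simp: case_prod_unfold)
      qed
      have 3: "continuous_map (top_of_set (\<phi> ` U)) X \<psi>"
        using c\<psi> continuous_map_in_subtopology by blast
      have "subtopology (prod_topology ?I X) ({0..1} \<times> U) = prod_topology ?I (subtopology X U)"
        by (simp add: subtopology_Times subtopology_subtopology)
      then show ?thesis
        using True continuous_map_compose[OF continuous_map_compose[OF 1 2] 3] by simp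
    next
      case False
      then show ?thesis
        by (simp add: continuous_map_from_subtopology continuous_map_snd)
    qed
  next
    fix b b' z
    assume "z \<in> topspace (prod_topology ?I X) \<inter> ({0..1} \<times> (if b then U else topspace X - C))
       \<inter> ({0..1} \<times> (if b' then U else topspace X - C))"
    then show "(if b then \<psi> \<circ> ((\<lambda>(t, x). push (t * \<epsilon> x) x) \<circ> (\<lambda>(t, q). (t, \<phi> q))) else snd) z =
      (if b' then \<psi> \<circ> ((\<lambda>(t, x). push (t * \<epsilon> x) x) \<circ> (\<lambda>(t, q). (t, \<phi> q))) else snd) z"
      using H_out[of "snd z" "fst z"] DC[of "snd z"]
      by (cases b; cases b'; cases "snd z \<in> D") (auto simp: H_def)
  next
    fix z assume z: "z \<in> topspace (prod_topology ?I X)"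
    show "\<exists>b. b \<in> UNIV \<and> z \<in> {0..1} \<times> (if b then U else topspace X - C) \<and>
      H z = (if b then \<psi> \<circ> ((\<lambda>(t, x). push (t * \<epsilon> x) x) \<circ> (\<lambda>(t, q). (t, \<phi> q))) else snd) z"
    proof (cases "snd z \<in> U")
      case True
      then show ?thesis using z by (intro exI[of _ True]) (auto simp: H_def)
    next
      case False
      have "C \<subseteq> U" unfolding C_def using r \<psi>U by blast
      then show ?thesis using z False by (intro exI[of _ False]) (auto simp: H_def)
    qed
  qed
  have HV: "H (t, q) \<in> V k" if "t \<in> {0..1}" "k \<in> {1, 2, 3}" "q \<in> V k" for t q k
  proof (cases "q \<in> D")
    case True
    then have q: "q \<in> U" by (simp add: D_iff)
    then have "gap k (\<phi> (H (t, q))) = max (gap k (\<phi> q) - t * \<epsilon> (\<phi> q)) 0"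
      using gapH that by blast
    moreover have "gap k (\<phi> q) \<le> 0" using V[OF that(2) q] that by blast
    moreover have "0 \<le> t * \<epsilon> (\<phi> q)" using that \<epsilon>0 by simp
    ultimately have "gap k (\<phi> (H (t, q))) \<le> 0" by simp
    then show ?thesis using V[OF that(2) H_in(1)[OF q that(1)]] by simp
  qed (use H_out that in simp)
  have "homotopic_with (\<lambda>h. \<forall>k\<in>{1, 2, 3}. h ` V k \<subseteq> V k) X X (\<lambda>x. H (0, x)) (\<lambda>x. H (1, x))"
    unfolding homotopic_with_def using cH HV by (intro exI[of _ H]) blast
  moreover have "(\<lambda>x. H (0, x)) = id"
    using \<psi>\<phi> by (auto simp: H_def push_0)
  ultimately have "homotopic_with (\<lambda>h. \<forall>k\<in>{1, 2, 3}. h ` V k \<subseteq> V k) X X id (\<lambda>x. H (1, x))"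
    by simp
  moreover have "\<exists>N. openin X N \<and> q \<in> N \<and> (\<lambda>x. H (1, x)) ` N \<subseteq> V k"
    if k: "k \<in> {1, 2, 3}" and q: "q \<in> D \<inter> V k" for k q
  proof -
    \<comment> \<open>At time 1 a gap below the local strength is lowered to zero, so
      \<open>N\<close> lands in \<open>V k\<close>. On \<open>D \<inter> V k\<close> the gap is at
      most zero while the strength is positive.\<close>
    define N where "N = {q \<in> topspace (subtopology X U). \<phi> q \<in> \<phi> ` U \<inter> {x. gap k x < \<epsilon> x}}"
    have "open {x. gap k x < \<epsilon> x}"
      unfolding \<epsilon>_def by (intro open_Collect_less continuous_intros) auto
    then have "openin (subtopology X U) N"
      unfolding N_def by (intro openin_continuous_map_preimage[OF c\<phi>]) auto
    then have "openin X N" using U openin_trans_full by blast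
    moreover have "q \<in> N"
    proof -
      have "q \<in> U" "0 < \<epsilon> (\<phi> q)" using q \<epsilon>_in by (auto simp: D_iff)
      moreover from this have "gap k (\<phi> q) \<le> 0" using V k q by blast
      ultimately show ?thesis using UX by (auto simp: N_def)
    qed
    moreover have "H (1, x) \<in> V k" if "x \<in> N" for x
    proof -
      have x: "x \<in> U" "gap k (\<phi> x) < \<epsilon> (\<phi> x)" using that by (auto simp: N_def)
      then have "gap k (\<phi> (H (1, x))) \<le> 0" using gapH[of x 1 k] k by simp
      then show ?thesis using V[OF k] H_in(1)[of x 1] x by simp
    qed
    ultimately show ?thesis by blast
  qed
  ultimately show ?thesis
    using that[of D "\<lambda>x. H (1, x)"] opD H_out p r by (auto simp: D_iff c_def)
qed

text \<open>
  The local maps are the identity outside their \<open>D\<close>, so under their composition a point is moved first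
  by a map that is good at this point, and the later maps preserve the sets \<open>V k\<close>.
\<close>

lemma global_push:
  fixes V :: "'i \<Rightarrow> 'a set"
  assumes X: "compact_space X" and V: "\<And>k. k \<in> K \<Longrightarrow> V k \<subseteq> topspace X"
    and loc: "\<And>p. p \<in> topspace X \<Longrightarrow> \<exists>g D. openin X D \<and> p \<in> D \<and>
      homotopic_with (\<lambda>h. \<forall>k\<in>K. h ` V k \<subseteq> V k) X X id g \<and>
      (\<forall>q. q \<notin> D \<longrightarrow> g q = q) \<and>
      (\<forall>k\<in>K. \<forall>q\<in>D \<inter> V k. \<exists>N. openin X N \<and> q \<in> N \<and> g ` N \<subseteq> V k)"
  obtains g where "homotopic_with (\<lambda>h. \<forall>k\<in>K. h ` V k \<subseteq> V k) X X id g"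
    "\<And>k. k \<in> K \<Longrightarrow> \<exists>N. openin X N \<and> V k \<subseteq> N \<and> g ` N \<subseteq> V k"
proof -
  define P where "P h \<longleftrightarrow> (\<forall>k\<in>K. h ` V k \<subseteq> V k)" for h :: "'a \<Rightarrow> 'a"
  define good where "good g q \<longleftrightarrow> (\<forall>k\<in>K. q \<in> V k \<longrightarrow> (\<exists>N. openin X N \<and> q \<in> N \<and> g ` N \<subseteq> V k))"
    for g :: "'a \<Rightarrow> 'a" and q
  define \<D> where "\<D> = {D. openin X D \<and> (\<exists>g. homotopic_with P X X id g \<and>
      (\<forall>q. q \<notin> D \<longrightarrow> g q = q) \<and> (\<forall>q\<in>D. good g q))}"
  have "topspace X \<subseteq> \<Union>\<D>"
  proof
    fix p assume "p \<in> topspace X"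
    then obtain g D where "openin X D" "p \<in> D" "homotopic_with P X X id g"
      "\<forall>q. q \<notin> D \<longrightarrow> g q = q" "\<forall>k\<in>K. \<forall>q\<in>D \<inter> V k. \<exists>N. openin X N \<and> q \<in> N \<and> g ` N \<subseteq> V k"
      using loc[of p] unfolding P_def by blast
    then show "p \<in> \<Union>\<D>" unfolding \<D>_def good_def by blast
  qed
  then obtain \<F> where \<F>: "finite \<F>" "\<F> \<subseteq> \<D>" "topspace X \<subseteq> \<Union>\<F>"
    using X unfolding compact_space_alt \<D>_def by (metis (no_types, lifting) mem_Collect_eq)
  from \<F>(1,2) have "\<exists>g. homotopic_with P X X id g \<and> (\<forall>q\<in>\<Union>\<F>. good g q)"
  proof (induction \<F>)
    case empty
    have "P id" by (simp add: P_def)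
    then have "homotopic_with P X X id id" by (simp only: homotopic_with_refl continuous_map_id)
    then show ?case by blast
  next
    case (insert D \<F>)
    have "\<F> \<subseteq> \<D>" using insert.prems by blast
    from insert.IH[OF this] obtain g where g: "homotopic_with P X X id g" "\<forall>q\<in>\<Union>\<F>. good g q"
      by (elim exE conjE)
    obtain l where l: "homotopic_with P X X id l" "\<forall>q. q \<notin> D \<longrightarrow> l q = q" "\<forall>q\<in>D. good l q"
      using insert.prems unfolding \<D>_def by blast
    have cl: "continuous_map X X l" "P l" and gP: "P g"
      using homotopic_with_imp_continuous_maps[OF l(1)] homotopic_with_imp_property[OF l(1)]
        homotopic_with_imp_property[OF g(1)] by blast+
    \<comment> \<open>The new map \<open>l\<close> acts first: the homotopy from \<open>id\<close>
      to \<open>l\<close> is continued by the old one precomposed with \<open>l\<close>.\<close>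
    have "homotopic_with P X X (id \<circ> l) (g \<circ> l)"
      by (rule homotopic_with_compose_continuous_map_right[OF g(1) cl(1)])
        (use cl(2) in \<open>fastforce simp: P_def\<close>)
    then have "homotopic_with P X X id (g \<circ> l)"
      using homotopic_with_trans[OF l(1)] by simp
    moreover have "good (g \<circ> l) q" if "q \<in> \<Union>(insert D \<F>)" for q
      unfolding good_def
    proof (intro ballI impI)
      fix k assume k: "k \<in> K" and q: "q \<in> V k"
      show "\<exists>N. openin X N \<and> q \<in> N \<and> (g \<circ> l) ` N \<subseteq> V k"
      proof (cases "q \<in> D")
        case True
        then obtain N where "openin X N" "q \<in> N" "l ` N \<subseteq> V k"
          using l(3) k q unfolding good_def by blast
        moreover from this have "(g \<circ> l) ` N \<subseteq> V k" using gP k unfolding P_def by fastforce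
        ultimately show ?thesis by blast
      next
        case False
        then have "q \<in> \<Union>\<F>" using that by blast
        then obtain N where N: "openin X N" "q \<in> N" "g ` N \<subseteq> V k"
          using g(2) k q unfolding good_def by blast
        \<comment> \<open>Here \<open>l\<close> fixes \<open>q\<close>, so a neighbourhood that is
          good for \<open>g\<close> can be pulled back along \<open>l\<close>.\<close>
        have "openin X {x \<in> topspace X. l x \<in> N}"
          using cl(1) N(1) by (rule openin_continuous_map_preimage)
        moreover have "q \<in> {x \<in> topspace X. l x \<in> N}" using False l(2) N V[OF k] q by auto
        ultimately show ?thesis using N(3) by fastforce
      qed
    qed
    ultimately show ?case by blast
  qed
  then obtain g where g: "homotopic_with P X X id g" "\<forall>q\<in>\<Union>\<F>. good g q" by blast
  have "\<exists>N. openin X N \<and> V k \<subseteq> N \<and> g ` N \<subseteq> V k" if k: "k \<in> K" for k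
  proof -
    let ?N = "\<Union>{N. openin X N \<and> g ` N \<subseteq> V k}"
    have "V k \<subseteq> ?N"
    proof
      fix q assume q: "q \<in> V k"
      then have "good g q" using g(2) \<F>(3) V[OF k] by blast
      then show "q \<in> ?N" using k q unfolding good_def by blast
    qed
    moreover have "openin X ?N" "g ` ?N \<subseteq> V k" by auto
    ultimately show ?thesis by blast
  qed
  then show ?thesis using that g(1) unfolding P_def by blast
qed

section \<open>Excision for the pieces of a trisection\<close>

text \<open>Empty boundary speaks of the charts in \<open>atlas\<close>, while
  \<open>three_sectors\<close> takes charts from \<open>max_atlas\<close>, whose images might a
  priori be open only in a half-space. Invariance of domain, applied to the transition from an atlas
  chart, excludes this.\<close>

lemma open_chart_image:
  fixes X :: "('a, 'e::euclidean_space) mfd"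
  assumes X: "smooth_manifold X" "mfd_boundary X = {}" and c: "(U, \<phi>) \<in> max_atlas X"
  shows "open (\<phi> ` U)"
  unfolding open_subopen[of "\<phi> ` U"]
proof
  fix y assume "y \<in> \<phi> ` U"
  then obtain p where p: "p \<in> U" "y = \<phi> p" by blast
  have U: "openin (mtop X) U" "homeomorphic_map (subtopology (mtop X) U) (top_of_set (\<phi> ` U)) \<phi>"
    using c by (auto simp: max_atlas_def is_chart_def)
  have "p \<in> topspace (mtop X)" using U p openin_subset by blast
  then obtain U' \<phi>' where d: "(U', \<phi>') \<in> atlas X" "p \<in> U'"
    using X(1) unfolding smooth_manifold_def by fastforce
  then have U': "openin (mtop X) U'" "homeomorphic_map (subtopology (mtop X) U') (top_of_set (\<phi>' ` U')) \<phi>'"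
    using X(1) by (auto simp: smooth_manifold_def is_chart_def)
  have int: "\<phi>' p \<in> interior (\<phi>' ` U')"
    using X(2) d unfolding mfd_boundary_def by blast
  have sub: "U \<subseteq> topspace (mtop X)" "U' \<subseteq> topspace (mtop X)"
    using U U' openin_subset by blast+
  obtain \<psi> where maps: "homeomorphic_maps (subtopology (mtop X) U') (top_of_set (\<phi>' ` U')) \<phi>' \<psi>"
    using U'(2) homeomorphic_map_maps by blast
  then have c\<psi>: "continuous_map (top_of_set (\<phi>' ` U')) (subtopology (mtop X) U') \<psi>"
    and \<psi>\<phi>: "\<And>q. q \<in> U' \<Longrightarrow> \<psi> (\<phi>' q) = q"
    using sub by (auto simp: homeomorphic_maps_def)
  have "openin (top_of_set (\<phi>' ` U')) {x \<in> topspace (top_of_set (\<phi>' ` U')). \<psi> x \<in> U' \<inter> U}"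
    by (rule openin_continuous_map_preimage[OF c\<psi>]) (use U in \<open>simp add: openin_subtopology_Int2\<close>)
  then obtain T where T: "open T" "{x \<in> \<phi>' ` U'. \<psi> x \<in> U' \<inter> U} = \<phi>' ` U' \<inter> T"
    by (auto simp: openin_open)
  \<comment> \<open>A Euclidean open set around the image of \<open>p\<close> on which the
    transition into the chart \<open>\<phi>\<close> is defined.\<close>
  define W where "W = interior (\<phi>' ` U') \<inter> T"
  have W: "open W" "W \<subseteq> {x \<in> \<phi>' ` U'. \<psi> x \<in> U}"
    using T interior_subset unfolding W_def by blast+
  have "\<phi>' p \<in> {x \<in> \<phi>' ` U'. \<psi> x \<in> U' \<inter> U}" using d p \<psi>\<phi> by auto
  then have "\<phi>' p \<in> W" using int T by (auto simp: W_def)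
  have "continuous_map (top_of_set W) (subtopology (mtop X) U) \<psi>"
  proof -
    have "continuous_map (top_of_set W) (mtop X) \<psi>"
      by (rule continuous_map_from_subtopology_mono[of _ "\<phi>' ` U'"])
        (use c\<psi> W(2) in \<open>auto simp: continuous_map_in_subtopology\<close>)
    then show ?thesis using W(2) by (auto simp: continuous_map_in_subtopology)
  qed
  then have "continuous_map (top_of_set W) (top_of_set (\<phi> ` U)) (\<phi> \<circ> \<psi>)"
    using U(2) homeomorphic_imp_continuous_map continuous_map_compose by blast
  then have "continuous_on W (\<phi> \<circ> \<psi>)" by simp
  moreover have "inj_on (\<phi> \<circ> \<psi>) W"
  proof (rule comp_inj_on)
    show "inj_on \<psi> W" using W(2) \<psi>\<phi> by (intro inj_on_inverseI[of _ \<phi>']) auto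
    have "inj_on \<phi> U" using homeomorphic_imp_injective_map[OF U(2)] sub by (simp add: inf.absorb2)
    then show "inj_on \<phi> (\<psi> ` W)" by (rule inj_on_subset) (use W(2) in auto)
  qed
  ultimately have "open ((\<phi> \<circ> \<psi>) ` W)" using W(1) invariance_of_domain by blast
  moreover have "y \<in> (\<phi> \<circ> \<psi>) ` W"
    using \<open>\<phi>' p \<in> W\<close> \<psi>\<phi> d p by (auto intro!: image_eqI[of _ _ "\<phi>' p"])
  moreover have "(\<phi> \<circ> \<psi>) ` W \<subseteq> \<phi> ` U" using W(2) by auto
  ultimately show "\<exists>T. open T \<and> y \<in> T \<and> T \<subseteq> \<phi> ` U" by blast
qed

text \<open>The sector charts give local pushes, compactness combines them into a single
  \<open>g\<close>, and \<open>excisive_subtopology\<close> is applied to it on three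
  subspaces.\<close>

lemma three_sectors_excisive:
  fixes X :: "('a, real^4) mfd"
  assumes X: "closed_oriented_manifold X" and sec: "three_sectors X V1 V2 V3"
    and cover: "V1 \<union> V2 \<union> V3 = topspace (mtop X)"
  shows "excisive (mtop X) V1 (V2 \<union> V3)"
    and "excisive (subtopology (mtop X) (V2 \<union> V3)) V2 V3"
    and "excisive (subtopology (mtop X) (V1 \<inter> (V2 \<union> V3))) (V1 \<inter> V2) (V1 \<inter> V3)"
proof -
  have man: "smooth_manifold X" "mfd_boundary X = {}" "compact_space (mtop X)" "Hausdorff_space (mtop X)"
    using X by (auto simp: closed_oriented_manifold_def smooth_manifold_def)
  define V where "V = (\<lambda>k::nat. if k = 1 then V1 else if k = 2 then V2 else V3)"
  have V: "V 1 = V1" "V 2 = V2" "V 3 = V3" by (simp_all add: V_def)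
  have loc: "\<exists>g D. openin (mtop X) D \<and> p \<in> D \<and>
      homotopic_with (\<lambda>h. \<forall>k\<in>{1, 2, 3}. h ` V k \<subseteq> V k) (mtop X) (mtop X) id g \<and>
      (\<forall>q. q \<notin> D \<longrightarrow> g q = q) \<and>
      (\<forall>k\<in>{1, 2, 3}. \<forall>q\<in>D \<inter> V k. \<exists>N. openin (mtop X) N \<and> q \<in> N \<and> g ` N \<subseteq> V k)"
    if p: "p \<in> topspace (mtop X)" for p
  proof -
    obtain U \<phi> where c: "(U, \<phi>) \<in> max_atlas X" "p \<in> U"
      and s: "\<forall>q\<in>U. (q \<in> V1 \<longleftrightarrow> 0 \<le> \<phi> q $ 1 \<and> 0 \<le> \<phi> q $ 2) \<and>
               (q \<in> V2 \<longleftrightarrow> \<phi> q $ 1 \<le> 0 \<and> \<phi> q $ 1 \<le> \<phi> q $ 2) \<and>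
               (q \<in> V3 \<longleftrightarrow> \<phi> q $ 2 \<le> 0 \<and> \<phi> q $ 2 \<le> \<phi> q $ 1)"
      using sec p unfolding three_sectors_def by blast
    have U: "openin (mtop X) U" "homeomorphic_map (subtopology (mtop X) U) (top_of_set (\<phi> ` U)) \<phi>"
      using c by (auto simp: max_atlas_def is_chart_def)
    have V_gap: "q \<in> V k \<longleftrightarrow> gap k (\<phi> q) \<le> 0" if "k \<in> {1, 2, 3}" "q \<in> U" for k q
      using that s by (auto simp: V gap_le_0 simp del: One_nat_def)
    obtain g D where "openin (mtop X) D" "p \<in> D"
      "homotopic_with (\<lambda>h. \<forall>k\<in>{1, 2, 3}. h ` V k \<subseteq> V k) (mtop X) (mtop X) id g"
      "\<And>q. q \<notin> D \<Longrightarrow> g q = q"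
      "\<And>k q. k \<in> {1, 2, 3} \<Longrightarrow> q \<in> D \<inter> V k \<Longrightarrow> \<exists>N. openin (mtop X) N \<and> q \<in> N \<and> g ` N \<subseteq> V k"
      by (rule local_push[OF man(4) U open_chart_image[OF man(1,2) c(1)] c(2) V_gap], assumption, assumption, rule that)
    then show ?thesis by (intro exI[of _ g] exI[of _ D]) simp
  qed
  have V_sub: "V k \<subseteq> topspace (mtop X)" for k
    using cover by (auto simp: V_def)
  obtain g where hom: "homotopic_with (\<lambda>h. \<forall>k\<in>{1, 2, 3}. h ` V k \<subseteq> V k) (mtop X) (mtop X) id g"
    and nbd: "\<And>k. k \<in> {1, 2, 3} \<Longrightarrow> \<exists>N. openin (mtop X) N \<and> V k \<subseteq> N \<and> g ` N \<subseteq> V k"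
    by (rule global_push[OF man(3) V_sub loc], assumption, rule that)
  obtain N1 N2 N3 where N: "openin (mtop X) N1" "V1 \<subseteq> N1" "g ` N1 \<subseteq> V1"
    "openin (mtop X) N2" "V2 \<subseteq> N2" "g ` N2 \<subseteq> V2" "openin (mtop X) N3" "V3 \<subseteq> N3" "g ` N3 \<subseteq> V3"
    using nbd[of 1] nbd[of 2] nbd[of 3] unfolding V by auto
  \<comment> \<open>Maps that preserve the three pieces preserve all unions and intersections of
    them, so the one homotopy fits each choice of \<open>Y\<close>, \<open>A\<close>,
    \<open>B\<close> below.\<close>
  have h: "homotopic_with (\<lambda>h. h ` Y \<subseteq> Y \<and> h ` A \<subseteq> A \<and> h ` B \<subseteq> B) (mtop X) (mtop X) id g"
    if "\<And>h. \<lbrakk>h ` V1 \<subseteq> V1; h ` V2 \<subseteq> V2; h ` V3 \<subseteq> V3\<rbrakk> \<Longrightarrow> h ` Y \<subseteq> Y \<and> h ` A \<subseteq> A \<and> h ` B \<subseteq> B"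
    for Y A B
    using hom by (rule homotopic_with_mono) (use that in \<open>simp add: V del: One_nat_def\<close>)
  have 1: "excisive (subtopology (mtop X) (V1 \<union> (V2 \<union> V3)))
      ((V1 \<union> (V2 \<union> V3)) \<inter> V1) ((V1 \<union> (V2 \<union> V3)) \<inter> (V2 \<union> V3))"
    by (rule excisive_subtopology[OF h, where N = N1 and N' = "N2 \<union> N3"]) (use N cover in blast)+
  have 2: "excisive (subtopology (mtop X) (V2 \<union> V3)) ((V2 \<union> V3) \<inter> V2) ((V2 \<union> V3) \<inter> V3)"
    by (rule excisive_subtopology[OF h, where N = N2 and N' = N3]) (use N cover in blast)+
  have 3: "excisive (subtopology (mtop X) (V1 \<inter> (V2 \<union> V3)))
      (V1 \<inter> (V2 \<union> V3) \<inter> V2) (V1 \<inter> (V2 \<union> V3) \<inter> V3)"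
    by (rule excisive_subtopology[OF h, where N = N2 and N' = N3]) (use N cover in blast)+
  have t: "subtopology (mtop X) (V1 \<union> (V2 \<union> V3)) = mtop X"
    using cover by (simp add: Un_assoc)
  show "excisive (mtop X) V1 (V2 \<union> V3)"
    using 1 unfolding t by (simp add: Int_absorb1 inf.absorb2)
  show "excisive (subtopology (mtop X) (V2 \<union> V3)) V2 V3"
    using 2 by (simp add: inf.absorb2)
  have "V1 \<inter> (V2 \<union> V3) \<inter> V2 = V1 \<inter> V2" "V1 \<inter> (V2 \<union> V3) \<inter> V3 = V1 \<inter> V3"
    by blast+
  with 3 show "excisive (subtopology (mtop X) (V1 \<inter> (V2 \<union> V3))) (V1 \<inter> V2) (V1 \<inter> V3)"
    by simp
qed

theorem corollary3p4:
  fixes X :: "('a, real^4) mfd"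
    and g k1 k2 k3 :: nat
    and S V1 V2 V3 :: "'a set"
  defines "L\<alpha> \<equiv> lagrangian (mtop X) S (V1 \<inter> V2)"
    and "L\<beta> \<equiv> lagrangian (mtop X) S (V1 \<inter> V3)"
    and "L\<gamma> \<equiv> lagrangian (mtop X) S (V2 \<inter> V3)"
  assumes "closed_oriented_manifold X"
    and "connected_space (mtop X)"
    and "trisection X g k1 k2 k3 S V1 V2 V3"
  shows "homology_group 3 (mtop X) \<cong>
           (homology_group 1 (subtopology (mtop X) S))\<lparr>carrier := L\<alpha> \<inter> L\<beta> \<inter> L\<gamma>\<rparr>"
proof -
  have cover: "V1 \<union> V2 \<union> V3 = topspace (mtop X)" and S: "S = V1 \<inter> V2 \<inter> V3"
    and sec: "three_sectors X V1 V2 V3"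
    using assms(6) by (simp_all add: trisection_def)
  note ex = three_sectors_excisive[OF assms(4) sec cover]
  have V: "trivial_group (homology_group k (subtopology (mtop X) V))"
    if v: "V \<in> {V1, V2, V3}" "3 - 1 \<le> k" "k \<le> 3" for V and k :: int
  \<comment> \<open>Straightening the corner changes only the smooth structure: \<open>M\<close>
    carries the subspace topology of \<open>V\<close>, so the vanishing for handlebodies applies to
    \<open>V\<close> itself.\<close>
  proof -
    obtain n where "(V, n) \<in> {(V1, k1), (V2, k2), (V3, k3)}"
      using v(1) by blast
    then obtain M where "corner_straightening X V S M" "handlebody4 n M"
      using assms(6) unfolding trisection_def by blast
    then show ?thesis
      using vanishing_homology_handlebody4[of n M] v
      by (auto simp: corner_straightening_def vanishing_homology_def)
  qed
  have W: "trivial_group (homology_group (3 - 1) (subtopology (mtop X) W))"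
    if "W \<in> {V1 \<inter> V2, V1 \<inter> V3, V2 \<inter> V3}" for W
  proof -
    have "handlebody3 g (submfd X W)"
      using assms(6) that unfolding trisection_def by blast
    then show ?thesis
      using vanishing_homology_handlebody3 by (fastforce simp: vanishing_homology_def)
  qed
  \<comment> \<open>The case \<open>p = 3\<close>: the handlebodies have no homology in degrees 2
    and 3, and the kernels in degree \<open>3 - 2 = 1\<close> are the Lagrangians.\<close>
  show ?thesis
    using homology_triad_iso[OF ex V W] by (simp add: L\<alpha>_def L\<beta>_def L\<gamma>_def lagrangian_def S)
qed

end
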